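(* Fix an ellipse (the elliptic billiard) $\frac{x^2}{a^2}+\frac{y^2}{b^2}=1$ with $a>b>0$. For each 3-periodic triangle of this billiard, let $r$ and $R$ be its inradius and circumradius, $\rho=r/R$, $d=|X_1X_3|=\sqrt{R(R-2r)}$ (the distance from incenter to circumcenter), and let $E_1$ be the circumellipse of the triangle centered at its incenter $X_1$, with major and minor semiaxis lengths $\eta_1'$ and $\eta_1$. Then, over the family of all 3-periodics of the billiard, $\eta_1'$ and $\eta_1$ are variable (neither is constant), but their ratio $\eta_1'/\eta_1$ is invariant (takes the same value for every 3-periodic of the billiard). Moreover, for every 3-periodic, $$\eta_1'=R+d,\qquad \eta_1=R-d,\qquad \frac{\eta_1'}{\eta_1}=\frac{R+d}{R-d}=\frac{1+\sqrt{1-2\rho}}{\rho}-1>1 .$$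
   Context: A 3-periodic of the elliptic billiard (EB) is a (non-degenerate) triangle inscribed in the ellipse such that at each vertex the normal to the ellipse is the internal angle bisector of the triangle, i.e. a closed billiard trajectory with three elastic bounces. Through each point of the ellipse there passes one such triangle, so they form a one-parameter family. A circumconic (circumellipse) of a triangle is a conic (ellipse) passing through its three vertices; the $X_1$-centered one is the one whose center is the incenter $X_1$ (it is always an ellipse, since $X_1$ is interior to the medial triangle). $X_3$ is the circumcenter. *)

theory Defs
  imports "HOL-Analysis.Analysis"
begin

definition elliptic_billiard :: "real \<Rightarrow> real \<Rightarrow> (real^2) set" where
  "elliptic_billiard a b = {p. (p$1)\<^sup>2 / a\<^sup>2 + (p$2)\<^sup>2 / b\<^sup>2 = 1}"

text \<open>The direction is half the gradient of \<open>x\<^sup>2 / a\<^sup>2 + y\<^sup>2 / b\<^sup>2\<close>.\<close>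

definition billiard_normal :: "real \<Rightarrow> real \<Rightarrow> real^2 \<Rightarrow> (real^2) set" where
  "billiard_normal a b p = range (\<lambda>t. p + t *\<^sub>R vector [p$1 / a\<^sup>2, p$2 / b\<^sup>2])"

text \<open>The line bisecting internally the angle at \<open>A\<close> (the first argument) of the triangle
  \<open>A B C\<close>: the sum of the unit vectors from \<open>A\<close> towards \<open>B\<close> and \<open>C\<close> spans its direction.\<close>

definition internal_bisector :: "real^2 \<Rightarrow> real^2 \<Rightarrow> real^2 \<Rightarrow> (real^2) set" where
  "internal_bisector A B C = range (\<lambda>t. A + t *\<^sub>R (sgn (B - A) + sgn (C - A)))"

definition three_periodic :: "real \<Rightarrow> real \<Rightarrow> real^2 \<Rightarrow> real^2 \<Rightarrow> real^2 \<Rightarrow> bool" where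
  "three_periodic a b A B C \<longleftrightarrow>
     \<not> collinear {A, B, C} \<and>
     {A, B, C} \<subseteq> elliptic_billiard a b \<and>
     billiard_normal a b A = internal_bisector A B C \<and>
     billiard_normal a b B = internal_bisector B C A \<and>
     billiard_normal a b C = internal_bisector C A B"

definition incenter :: "real^2 \<Rightarrow> real^2 \<Rightarrow> real^2 \<Rightarrow> real^2" where
  "incenter A B C = (THE I. I \<in> internal_bisector A B C \<and>
     I \<in> internal_bisector B C A \<and> I \<in> internal_bisector C A B)"

text \<open>The incenter is equidistant from the three side lines, so one side suffices.\<close>

definition inradius :: "real^2 \<Rightarrow> real^2 \<Rightarrow> real^2 \<Rightarrow> real" where
  "inradius A B C = infdist (incenter A B C) (affine hull {A, B})"

definition circumcenter :: "real^2 \<Rightarrow> real^2 \<Rightarrow> real^2 \<Rightarrow> real^2" where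
  "circumcenter A B C = (THE P. dist P A = dist P B \<and> dist P B = dist P C)"

definition circumradius :: "real^2 \<Rightarrow> real^2 \<Rightarrow> real^2 \<Rightarrow> real" where
  "circumradius A B C = dist (circumcenter A B C) A"

text \<open>\<open>is_ellipse E c p q\<close>: the set \<open>E\<close> is an ellipse with center \<open>c\<close>, major semiaxis \<open>p\<close> and
  minor semiaxis \<open>q\<close>; the axes have arbitrary orthogonal unit directions \<open>u\<close>, \<open>v\<close>, and circles
  are included.\<close>

definition is_ellipse :: "(real^2) set \<Rightarrow> real^2 \<Rightarrow> real \<Rightarrow> real \<Rightarrow> bool" where
  "is_ellipse E c p q \<longleftrightarrow> 0 < q \<and> q \<le> p \<and>
     (\<exists>u v. norm u = 1 \<and> norm v = 1 \<and> u \<bullet> v = 0 \<and>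
        E = {c + x *\<^sub>R u + y *\<^sub>R v | x y. x\<^sup>2 / p\<^sup>2 + y\<^sup>2 / q\<^sup>2 = 1})"

definition major_semiaxis :: "(real^2) set \<Rightarrow> real" where
  "major_semiaxis E = (THE p. \<exists>c q. is_ellipse E c p q)"

definition minor_semiaxis :: "(real^2) set \<Rightarrow> real" where
  "minor_semiaxis E = (THE q. \<exists>c p. is_ellipse E c p q)"

text \<open>The circumellipse of the triangle \<open>A B C\<close> with prescribed center \<open>c\<close>; it exists and is unique
  when \<open>c\<close> lies in the interior of the medial triangle, as the incenter does.\<close>

definition circumellipse :: "real^2 \<Rightarrow> real^2 \<Rightarrow> real^2 \<Rightarrow> real^2 \<Rightarrow> (real^2) set" where
  "circumellipse A B C c = (THE E. (\<exists>p q. is_ellipse E c p q) \<and> {A, B, C} \<subseteq> E)"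

definition incenter_circumellipse :: "real^2 \<Rightarrow> real^2 \<Rightarrow> real^2 \<Rightarrow> (real^2) set" where
  "incenter_circumellipse A B C = circumellipse A B C (incenter A B C)"

end

(*
Write the vertices of a triangle with circumcenter 0 and circumradius 1 as u^2, v^2, w^2 with unit
complex numbers u, v, w. For suitable signs of the roots the incenter is I = -(uv + vw + wu), and
u^2 - I = vw + kappa * cnj (vw) with kappa = uvw (u + v + w), symmetrically for the other vertices.
The map z |-> z + kappa * cnj z takes the unit circle to an ellipse with semiaxes 1 + |kappa| and
1 - |kappa|, and |kappa| = |u + v + w| = |I| = d; moreover 1 - 2r = |kappa|^2.

For the billiard, the reflection law says that 1 - Re (z * cnj z') = J * |P - P'| for each side PP',
with one constant J for the triangle, where z is the image of P on the unit circle under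
(x, y) |-> (x/a, y/b). Squaring turns this into Re (z * cnj z') - k * Re (z * z') = K with
k = J^2 (a^2 - b^2), for all three pairs. Eliminating gives |z1 + z2 + z3| = k and 1 + 2K = k^2. The
latter determines k > 0 from a and b. Multiplying J by the perimeter gives 3 plus the sum of the
cosines of the angles, whence |u + v + w| = |z1 + z2 + z3| = k. So the ratio is (1 + k) / (1 - k).
The two isosceles billiard triangles with a vertex at (0, b) and at (a, 0) have different
circumradii, and thus neither semiaxis is constant.
*)

theory Submission
  imports Defs
begin

subsection \<open>The Euclidean plane\<close>

text \<open>Identifying the plane with the complex numbers turns the triangle geometry into algebra
  with unit numbers, their conjugates and their square roots.\<close>

definition vec_of :: "complex \<Rightarrow> real^2" where
  "vec_of z = vector [Re z, Im z]"

lemma vec_of_nth [simp]: "vec_of z $ 1 = Re z" "vec_of z $ 2 = Im z"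
  by (simp_all add: vec_of_def)

lemma vec_of_surj: "\<exists>z. A = vec_of z"
  by (rule exI[of _ "Complex (A$1) (A$2)"]) (simp add: vec_eq_iff forall_2)

lemma vec_of_eq_iff [simp]: "vec_of x = vec_of y \<longleftrightarrow> x = y"
  by (auto simp: vec_eq_iff forall_2 complex_eq_iff)

lemma vec_of_add: "vec_of (x + y) = vec_of x + vec_of y"
  and vec_of_diff: "vec_of (x - y) = vec_of x - vec_of y"
  and vec_of_scaleR: "vec_of (t *\<^sub>R x) = t *\<^sub>R vec_of x"
  by (simp_all add: vec_eq_iff forall_2)

lemma inner_2: "(x :: real^2) \<bullet> y = x$1 * y$1 + x$2 * y$2"
  by (simp add: inner_vec_def UNIV_2)

lemma norm_2: "norm (x :: real^2) = sqrt ((x$1)\<^sup>2 + (x$2)\<^sup>2)"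
  by (simp add: norm_eq_sqrt_inner inner_2 power2_eq_square)

lemma inner_vec_of: "vec_of x \<bullet> vec_of y = Re (x * cnj y)"
  by (simp add: inner_2)

lemma norm_vec_of [simp]: "norm (vec_of z) = cmod z"
  by (simp add: norm_eq_sqrt_inner[of "vec_of z"] inner_2 cmod_def power2_eq_square)

lemma dist_vec_of: "dist (vec_of x) (vec_of y) = cmod (x - y)"
  by (simp add: dist_norm flip: vec_of_diff)

lemma sgn_vec_of: "sgn (vec_of z) = vec_of (sgn z)"
  by (simp add: sgn_div_norm vec_of_scaleR)

section \<open>Parallelism and collinearity in coordinates\<close>

definition cross2 :: "real^2 \<Rightarrow> real^2 \<Rightarrow> real" where
  "cross2 x y = x$1 * y$2 - x$2 * y$1"

lemma cross2_vec_of: "cross2 (vec_of x) (vec_of y) = Im (cnj x * y)"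
  by (simp add: cross2_def)

text \<open>\<open>Q - P\<close> is a multiple of both directions; crossing it with \<open>e\<close>
  leaves \<open>(t' - t) * cross2 d e = 0\<close>. This gives the uniqueness required by the
  \<open>THE\<close> in \<open>incenter\<close>.\<close>

lemma lines_meet_once:
  assumes "cross2 d e \<noteq> 0" "P - A = t *\<^sub>R d" "P - B = s *\<^sub>R e" "Q - A = t' *\<^sub>R d" "Q - B = s' *\<^sub>R e"
  shows "Q = P"
proof -
  have *: "Q - P = (t' - t) *\<^sub>R d" "Q - P = (s' - s) *\<^sub>R e"
    unfolding scaleR_left_diff_distrib assms(2-5)[symmetric] by simp_all
  have "(t' - t) * cross2 d e = cross2 (Q - P) e"
    unfolding cross2_def *(1) by (simp add: algebra_simps)
  also have "\<dots> = 0" unfolding cross2_def *(2) by simp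
  finally have "t' - t = 0" using assms(1) by simp
  then show ?thesis using *(1) by simp
qed

text \<open>The difference of the two sides is always the cross product of \<open>x\<close> and
  \<open>y\<close> times \<open>x\<close> turned by a right angle, so it vanishes with the cross
  product.\<close>

lemma inner_swap_if_parallel:
  fixes x y :: "real^2"
  assumes "x$1 * y$2 = x$2 * y$1"
  shows "(x \<bullet> x) *\<^sub>R y = (y \<bullet> x) *\<^sub>R x"
proof -
  have "(x \<bullet> x) * y$1 = (y \<bullet> x) * x$1 - x$2 * (x$1 * y$2 - x$2 * y$1)"
    "(x \<bullet> x) * y$2 = (y \<bullet> x) * x$2 + x$1 * (x$1 * y$2 - x$2 * y$1)"
    by (simp_all add: inner_2 algebra_simps)
  then show ?thesis
    by (simp add: vec_eq_iff forall_2 assms)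
qed

lemma cross_eq_0_if_collinear:
  fixes A B C :: "real^2"
  assumes "collinear {A, B, C}"
  shows "(B$1 - A$1) * (C$2 - A$2) = (B$2 - A$2) * (C$1 - A$1)"
proof (cases "A = C")
  case False
  then obtain u where "B = u *\<^sub>R A + (1 - u) *\<^sub>R C"
    using assms unfolding collinear_3_expand by blast
  then have B: "B$1 = u * A$1 + (1 - u) * C$1" "B$2 = u * A$2 + (1 - u) * C$2" by simp_all
  show ?thesis unfolding B by (simp add: algebra_simps)
qed simp

lemma collinear_if_cross_eq_0:
  fixes A B C :: "real^2"
  assumes "(B$1 - A$1) * (C$2 - A$2) = (B$2 - A$2) * (C$1 - A$1)"
  shows "collinear {A, B, C}"
proof (cases "B = A")
  case True
  then show ?thesis by simp
next
  case False
  define t where "t = ((C - A) \<bullet> (B - A)) / ((B - A) \<bullet> (B - A))"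
  have nz: "(B - A) \<bullet> (B - A) \<noteq> 0" using False by simp
  have "((B - A) \<bullet> (B - A)) *\<^sub>R (C - A) = ((C - A) \<bullet> (B - A)) *\<^sub>R (B - A)"
    using assms by (intro inner_swap_if_parallel) simp
  then have "C - A = t *\<^sub>R (B - A)"
    using nz unfolding t_def
    by (metis (no_types, lifting) divideR_right divide_inverse_commute scaleR_scaleR)
  then have "C - A = t *\<^sub>R (B - A)" "B - A = 1 *\<^sub>R (B - A)" "A - A = 0 *\<^sub>R (B - A)"
    by auto
  then have "\<forall>y\<in>{A,B,C}. \<exists>c. y - A = c *\<^sub>R (B - A)" by blast
  then have "\<forall>x\<in>{A,B,C}. \<forall>y\<in>{A,B,C}. \<exists>c. x - y = c *\<^sub>R (B - A)"
    by (metis (no_types, opaque_lifting) diff_diff_eq2 diff_add_cancel scaleR_left_diff_distrib)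
  then show ?thesis unfolding collinear_def by blast
qed

text \<open>The orthogonal complement of \<open>f\<close> in the plane is a line: each coordinate of
  \<open>f\<close> times the cross product of \<open>x\<close> and \<open>g\<close> is a combination
  of \<open>x \<bullet> f\<close> and \<open>g \<bullet> f\<close>.\<close>

lemma parallel_if_orthogonal_2:
  fixes x f g :: "real^2"
  assumes "f \<noteq> 0" "g \<noteq> 0" "x \<bullet> f = 0" "g \<bullet> f = 0"
  shows "\<exists>t. x = t *\<^sub>R g"
proof -
  have "f$1 \<noteq> 0 \<or> f$2 \<noteq> 0" using assms(1) by (auto simp: vec_eq_iff forall_2)
  moreover have "f$1 * (x$1 * g$2 - x$2 * g$1) = g$2 * (x \<bullet> f) - x$2 * (g \<bullet> f)"
      "f$2 * (x$1 * g$2 - x$2 * g$1) = x$1 * (g \<bullet> f) - g$1 * (x \<bullet> f)"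
    unfolding inner_2 by (simp_all add: algebra_simps)
  ultimately have "g$1 * x$2 = g$2 * x$1" using assms(3,4) by (auto simp: algebra_simps)
  then have eq: "(g \<bullet> g) *\<^sub>R x = (x \<bullet> g) *\<^sub>R g"
    by (rule inner_swap_if_parallel)
  have "x = (x \<bullet> g / (g \<bullet> g)) *\<^sub>R g"
  proof -
    have "x = (1 / (g \<bullet> g)) *\<^sub>R ((g \<bullet> g) *\<^sub>R x)" using assms(2) by simp
    also have "\<dots> = (x \<bullet> g / (g \<bullet> g)) *\<^sub>R g" by (simp only: eq scaleR_scaleR) simp
    finally show ?thesis .
  qed
  then show ?thesis by blast
qed

subsection \<open>Ellipses\<close>

text \<open>The matrix with columns \<open>u\<close> and \<open>v\<close> is orthogonal, so its rows
  are orthonormal as well.\<close>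

lemma orthonormal_pair_transpose:
  fixes u v :: "real^2"
  assumes "norm u = 1" "norm v = 1" "u \<bullet> v = 0"
  shows "u$1 * u$1 + v$1 * v$1 = 1" "u$1 * u$2 + v$1 * v$2 = 0" "u$2 * u$2 + v$2 * v$2 = 1"
proof -
  have *: "u$1 * u$1 + u$2 * u$2 = 1" "v$1 * v$1 + v$2 * v$2 = 1" "u$1 * v$1 + u$2 * v$2 = 0"
    using assms by (simp_all add: norm_eq_1 inner_2)
  have "u$1 * v$1 = - (u$2 * v$2)" using *(3) by simp
  then have uv: "(u$1)\<^sup>2 * (v$1)\<^sup>2 = (u$2)\<^sup>2 * (v$2)\<^sup>2"
    by (simp flip: power_mult_distrib)
  have "(v$1)\<^sup>2 = (v$1)\<^sup>2 * (u$1 * u$1 + u$2 * u$2)" using *(1) by simp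
  also have "\<dots> = (u$2)\<^sup>2 * (v$1 * v$1 + v$2 * v$2)"
    using uv by (simp add: algebra_simps flip: power2_eq_square)
  finally have vu: "v$1 * v$1 = u$2 * u$2" using *(2) by (simp add: power2_eq_square)
  show 1: "u$1 * u$1 + v$1 * v$1 = 1" and 2: "u$2 * u$2 + v$2 * v$2 = 1"
    using vu *(1,2) by simp_all
  have "(u$1 * u$2 + v$1 * v$2)\<^sup>2 =
      (u$1 * u$1) * (u$2 * u$2) + 2 * (u$1 * v$1) * (u$2 * v$2) + (v$1 * v$1) * (v$2 * v$2)"
    by (simp add: power2_eq_square algebra_simps)
  also have "\<dots> = (u$1 * v$1 + u$2 * v$2) * (u$1 * v$1 + u$2 * v$2)"
    using vu *(1,2) by (simp add: algebra_simps)
  finally show "u$1 * u$2 + v$1 * v$2 = 0" using *(3) by simp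
qed

lemma orthonormal_pair_expand:
  fixes u v w :: "real^2"
  assumes "norm u = 1" "norm v = 1" "u \<bullet> v = 0"
  shows "w = (w \<bullet> u) *\<^sub>R u + (w \<bullet> v) *\<^sub>R v"
proof -
  note o = orthonormal_pair_transpose[OF assms]
  have "(w \<bullet> u) * u$1 + (w \<bullet> v) * v$1 = w$1 * (u$1 * u$1 + v$1 * v$1) + w$2 * (u$1 * u$2 + v$1 * v$2)"
    "(w \<bullet> u) * u$2 + (w \<bullet> v) * v$2 = w$1 * (u$1 * u$2 + v$1 * v$2) + w$2 * (u$2 * u$2 + v$2 * v$2)"
    unfolding inner_2 by (simp_all add: algebra_simps)
  then show ?thesis by (simp add: vec_eq_iff forall_2 o)
qed

section \<open>Uniqueness of an ellipse with given center through three points\<close>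

text \<open>Passing from axes to a quadratic form makes the unknowns enter linearly, so that
  incidence with three points becomes a linear system.\<close>

lemma is_ellipse_quadratic_form:
  assumes "is_ellipse E c p q"
  shows "\<exists>\<alpha> \<beta> \<gamma>. E = {z. \<alpha> * ((z - c)$1)\<^sup>2 + \<beta> * ((z - c)$1) * ((z - c)$2) + \<gamma> * ((z - c)$2)\<^sup>2 = 1}"
proof -
  obtain u v where uv: "norm u = 1" "norm v = 1" "u \<bullet> v = 0"
    and E: "E = {c + x *\<^sub>R u + y *\<^sub>R v | x y. x\<^sup>2 / p\<^sup>2 + y\<^sup>2 / q\<^sup>2 = 1}"
    using assms unfolding is_ellipse_def by blast
  have nuv: "u \<bullet> u = 1" "v \<bullet> v = 1" "v \<bullet> u = 0"
    using uv by (simp_all add: norm_eq_1 inner_commute)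
  have form: "E = {z. ((z - c) \<bullet> u)\<^sup>2 / p\<^sup>2 + ((z - c) \<bullet> v)\<^sup>2 / q\<^sup>2 = 1}"
  proof (intro set_eqI iffI)
    fix z assume "z \<in> E"
    then obtain x y where "z = c + x *\<^sub>R u + y *\<^sub>R v" "x\<^sup>2 / p\<^sup>2 + y\<^sup>2 / q\<^sup>2 = 1"
      unfolding E by blast
    then show "z \<in> {z. ((z - c) \<bullet> u)\<^sup>2 / p\<^sup>2 + ((z - c) \<bullet> v)\<^sup>2 / q\<^sup>2 = 1}"
      using nuv uv(3) by (simp add: inner_add_left)
  next
    fix z assume z: "z \<in> {z. ((z - c) \<bullet> u)\<^sup>2 / p\<^sup>2 + ((z - c) \<bullet> v)\<^sup>2 / q\<^sup>2 = 1}"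
    have "z = c + ((z - c) \<bullet> u) *\<^sub>R u + ((z - c) \<bullet> v) *\<^sub>R v"
      using orthonormal_pair_expand[OF uv, of "z - c"] by (simp add: algebra_simps)
    then show "z \<in> E" unfolding E using z by blast
  qed
  have coords: "((z - c) \<bullet> u)\<^sup>2 / p\<^sup>2 + ((z - c) \<bullet> v)\<^sup>2 / q\<^sup>2 =
      ((u$1)\<^sup>2 / p\<^sup>2 + (v$1)\<^sup>2 / q\<^sup>2) * ((z - c)$1)\<^sup>2
      + 2 * (u$1 * u$2 / p\<^sup>2 + v$1 * v$2 / q\<^sup>2) * ((z - c)$1) * ((z - c)$2)
      + ((u$2)\<^sup>2 / p\<^sup>2 + (v$2)\<^sup>2 / q\<^sup>2) * ((z - c)$2)\<^sup>2" for z
    unfolding inner_2 divide_inverse power2_eq_square by (simp only: algebra_simps)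
  show ?thesis unfolding form coords by (intro exI) (rule refl)
qed

text \<open>The linear system for the coefficients has a homogeneous Vandermonde determinant, which
  is up to sign the product of the three cross products. The identities in the proof are Cramer's
  rule.\<close>

lemma quadratic_form_eq_0:
  fixes x1 y1 x2 y2 x3 y3 :: real
  assumes "\<alpha> * x1\<^sup>2 + \<beta> * x1 * y1 + \<gamma> * y1\<^sup>2 = 0"
    "\<alpha> * x2\<^sup>2 + \<beta> * x2 * y2 + \<gamma> * y2\<^sup>2 = 0"
    "\<alpha> * x3\<^sup>2 + \<beta> * x3 * y3 + \<gamma> * y3\<^sup>2 = 0"
    and "x1 * y2 - y1 * x2 \<noteq> 0" "x2 * y3 - y2 * x3 \<noteq> 0" "x3 * y1 - y3 * x1 \<noteq> 0"
  shows "\<alpha> = 0 \<and> \<beta> = 0 \<and> \<gamma> = 0"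
proof -
  let ?D = "(x1 * y2 - y1 * x2) * (x2 * y3 - y2 * x3) * (x3 * y1 - y3 * x1)"
  let ?f = "\<lambda>x y. \<alpha> * x\<^sup>2 + \<beta> * x * y + \<gamma> * y\<^sup>2"
  have "\<alpha> * ?D = - (?f x1 y1 * (y2 * y3 * (x2 * y3 - x3 * y2)) - ?f x2 y2 * (y1 * y3 * (x1 * y3 - x3 * y1))
      + ?f x3 y3 * (y1 * y2 * (x1 * y2 - x2 * y1)))"
    "\<beta> * ?D = ?f x1 y1 * (x2\<^sup>2 * y3\<^sup>2 - y2\<^sup>2 * x3\<^sup>2) - ?f x2 y2 * (x1\<^sup>2 * y3\<^sup>2 - y1\<^sup>2 * x3\<^sup>2)
      + ?f x3 y3 * (x1\<^sup>2 * y2\<^sup>2 - y1\<^sup>2 * x2\<^sup>2)"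
    "\<gamma> * ?D = - (?f x1 y1 * (x2 * x3 * (x2 * y3 - x3 * y2)) - ?f x2 y2 * (x1 * x3 * (x1 * y3 - x3 * y1))
      + ?f x3 y3 * (x1 * x2 * (x1 * y2 - x2 * y1)))"
    by (simp_all add: algebra_simps power2_eq_square)
  then have "\<alpha> * ?D = 0" "\<beta> * ?D = 0" "\<gamma> * ?D = 0"
    unfolding assms(1-3) by simp_all
  then show ?thesis using assms(4-6) by simp
qed

text \<open>The difference of the two quadratic forms vanishes at three pairwise non-parallel
  vectors. The cross product conditions say that \<open>c\<close> lies on none of the three side
  lines.\<close>

lemma ellipse_unique:
  assumes E: "is_ellipse E c p q" "{A, B, C} \<subseteq> E"
    and E': "is_ellipse E' c p' q'" "{A, B, C} \<subseteq> E'"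
    and "cross2 (A - c) (B - c) \<noteq> 0" "cross2 (B - c) (C - c) \<noteq> 0" "cross2 (C - c) (A - c) \<noteq> 0"
  shows "E = E'"
proof -
  obtain \<alpha> \<beta> \<gamma> where 1: "E = {z. \<alpha> * ((z - c)$1)\<^sup>2 + \<beta> * ((z - c)$1) * ((z - c)$2) + \<gamma> * ((z - c)$2)\<^sup>2 = 1}"
    using is_ellipse_quadratic_form[OF E(1)] by blast
  obtain \<alpha>' \<beta>' \<gamma>' where 2: "E' = {z. \<alpha>' * ((z - c)$1)\<^sup>2 + \<beta>' * ((z - c)$1) * ((z - c)$2) + \<gamma>' * ((z - c)$2)\<^sup>2 = 1}"
    using is_ellipse_quadratic_form[OF E'(1)] by blast
  have *: "(\<alpha> - \<alpha>') * ((P - c)$1)\<^sup>2 + (\<beta> - \<beta>') * ((P - c)$1) * ((P - c)$2) + (\<gamma> - \<gamma>') * ((P - c)$2)\<^sup>2 = 0"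
    if "P \<in> {A, B, C}" for P
  proof -
    have "P \<in> E" "P \<in> E'" using that E(2) E'(2) by auto
    then show ?thesis unfolding 1 2 mem_Collect_eq by (simp only: left_diff_distrib)
  qed
  have "\<alpha> - \<alpha>' = 0 \<and> \<beta> - \<beta>' = 0 \<and> \<gamma> - \<gamma>' = 0"
    by (rule quadratic_form_eq_0[OF *[of A] *[of B] *[of C]])
       (use assms(5-7) in \<open>simp_all add: cross2_def\<close>)
  then show ?thesis unfolding 1 2 by simp
qed

section \<open>Center and semiaxes are determined by the set\<close>

text \<open>These metric properties recover the parameters from the bare set: the extreme distances
  from the center are the semiaxes, and the point symmetry pins down the center.\<close>

lemma is_ellipse_extremal:
  assumes "is_ellipse E c p q"
  shows "z \<in> E \<Longrightarrow> q \<le> dist z c" "z \<in> E \<Longrightarrow> dist z c \<le> p"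
    and "\<exists>z\<in>E. dist z c = p" "\<exists>z\<in>E. dist z c = q"
    and "z \<in> E \<Longrightarrow> 2 *\<^sub>R c - z \<in> E"
proof -
  obtain u v where uv: "norm u = 1" "norm v = 1" "u \<bullet> v = 0" and pq: "0 < q" "q \<le> p"
    and E: "E = {c + x *\<^sub>R u + y *\<^sub>R v | x y. x\<^sup>2 / p\<^sup>2 + y\<^sup>2 / q\<^sup>2 = 1}"
    using assms unfolding is_ellipse_def by blast
  have sq: "q\<^sup>2 \<le> p\<^sup>2" "q\<^sup>2 > 0" "p\<^sup>2 > 0" using pq by (simp_all add: power_mono)
  have d: "dist z c = sqrt (x\<^sup>2 + y\<^sup>2)" if "z = c + x *\<^sub>R u + y *\<^sub>R v" for x y
    using uv that by (simp add: dist_norm norm_eq_sqrt_inner norm_eq_1 inner_add_left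
        inner_add_right inner_commute power2_eq_square)
  have *: "\<exists>x y. z = c + x *\<^sub>R u + y *\<^sub>R v \<and> q\<^sup>2 \<le> x\<^sup>2 + y\<^sup>2 \<and> x\<^sup>2 + y\<^sup>2 \<le> p\<^sup>2" if "z \<in> E"
  proof -
    obtain x y where xy: "z = c + x *\<^sub>R u + y *\<^sub>R v" "x\<^sup>2 / p\<^sup>2 + y\<^sup>2 / q\<^sup>2 = 1"
      using \<open>z \<in> E\<close> unfolding E by blast
    have "x\<^sup>2 / p\<^sup>2 * q\<^sup>2 \<le> x\<^sup>2 / p\<^sup>2 * p\<^sup>2" "y\<^sup>2 / q\<^sup>2 * q\<^sup>2 \<le> y\<^sup>2 / q\<^sup>2 * p\<^sup>2"
      using sq by (intro mult_left_mono; simp)+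
    moreover have "x\<^sup>2 / p\<^sup>2 * p\<^sup>2 = x\<^sup>2" "y\<^sup>2 / q\<^sup>2 * q\<^sup>2 = y\<^sup>2" using sq by simp_all
    moreover have "x\<^sup>2 / p\<^sup>2 * q\<^sup>2 + y\<^sup>2 / q\<^sup>2 * q\<^sup>2 = q\<^sup>2" "x\<^sup>2 / p\<^sup>2 * p\<^sup>2 + y\<^sup>2 / q\<^sup>2 * p\<^sup>2 = p\<^sup>2"
      using xy(2) by (metis distrib_right mult_1)+
    ultimately show ?thesis using xy(1) by (intro exI[of _ x] exI[of _ y]) linarith
  qed
  show "q \<le> dist z c" if "z \<in> E"
    using *[OF that] d pq real_le_rsqrt by force
  show "dist z c \<le> p" if "z \<in> E"
    using *[OF that] d pq real_le_lsqrt by (metis less_imp_le order_trans sum_power2_ge_zero)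
  have "c + p *\<^sub>R u + 0 *\<^sub>R v \<in> E" "c + 0 *\<^sub>R u + q *\<^sub>R v \<in> E"
    unfolding E mem_Collect_eq using sq
    by (rule_tac x=p in exI, rule_tac x=0 in exI, simp, rule_tac x=0 in exI, rule_tac x=q in exI, simp)
  moreover have "dist (c + p *\<^sub>R u + 0 *\<^sub>R v) c = p" "dist (c + 0 *\<^sub>R u + q *\<^sub>R v) c = q"
    using uv pq by (simp_all add: dist_norm)
  ultimately show "\<exists>z\<in>E. dist z c = p" "\<exists>z\<in>E. dist z c = q" by blast+
  show "2 *\<^sub>R c - z \<in> E" if z: "z \<in> E"
  proof -
    obtain x y where xy: "z = c + x *\<^sub>R u + y *\<^sub>R v" "x\<^sup>2 / p\<^sup>2 + y\<^sup>2 / q\<^sup>2 = 1"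
      using z unfolding E by blast
    have "2 *\<^sub>R c - z = c + (-x) *\<^sub>R u + (-y) *\<^sub>R v" using xy(1) by (simp add: scaleR_2)
    then show ?thesis unfolding E using xy(2) by (metis (mono_tags, lifting) mem_Collect_eq power2_minus)
  qed
qed

text \<open>Two point symmetries compose to a translation by \<open>2 *\<^sub>R (c' - c)\<close>
  that preserves \<open>E\<close>. Moving a farthest point \<open>z\<close> by it in both directions
  must not increase the distance from \<open>c\<close>, and the parallelogram law then forces the
  translation to be zero.\<close>

lemma is_ellipse_center_unique:
  assumes "is_ellipse E c p q" "is_ellipse E c' p' q'"
  shows "c = c'"
proof -
  obtain z where z: "z \<in> E" "dist z c = p" using is_ellipse_extremal(3)[OF assms(1)] by blast
  let ?t = "2 *\<^sub>R (c' - c)"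
  have "2 *\<^sub>R c' - (2 *\<^sub>R c - z) \<in> E" "2 *\<^sub>R c - (2 *\<^sub>R c' - z) \<in> E"
    using z(1) assms is_ellipse_extremal(5) by blast+
  then have "dist (2 *\<^sub>R c' - (2 *\<^sub>R c - z)) c \<le> p" "dist (2 *\<^sub>R c - (2 *\<^sub>R c' - z)) c \<le> p"
    using is_ellipse_extremal(2)[OF assms(1)] by blast+
  then have n: "norm ((z - c) + ?t) \<le> p" "norm ((z - c) - ?t) \<le> p"
    by (simp_all add: dist_norm algebra_simps)
  have "(norm ((z - c) + ?t))\<^sup>2 + (norm ((z - c) - ?t))\<^sup>2 = 2 * (norm (z - c))\<^sup>2 + 2 * (norm ?t)\<^sup>2"
    unfolding power2_norm_eq_inner by (simp add: inner_simps inner_commute)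
  moreover have "(norm ((z - c) + ?t))\<^sup>2 \<le> p\<^sup>2" "(norm ((z - c) - ?t))\<^sup>2 \<le> p\<^sup>2"
    using n by (simp_all add: power_mono)
  moreover have "(norm (z - c))\<^sup>2 = p\<^sup>2" using z(2) by (simp add: dist_norm)
  ultimately have "(norm ?t)\<^sup>2 \<le> 0" by linarith
  then show ?thesis by simp
qed

lemma is_ellipse_axes_unique:
  assumes "is_ellipse E c p q" "is_ellipse E c' p' q'"
  shows "p = p'" "q = q'"
proof -
  have c: "c' = c" using is_ellipse_center_unique[OF assms] by simp
  note 1 = is_ellipse_extremal[OF assms(1)] and 2 = is_ellipse_extremal[OF assms(2), unfolded c]
  show "p = p'" using 1(2,3) 2(2,3) by (metis order_antisym)
  show "q = q'" using 1(1,4) 2(1,4) by (metis order_antisym)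
qed

lemma semiaxes_eq:
  assumes "is_ellipse E c p q"
  shows "major_semiaxis E = p" "minor_semiaxis E = q"
  unfolding major_semiaxis_def minor_semiaxis_def
  using assms is_ellipse_axes_unique by (blast intro!: the_equality)+

subsection \<open>Triangles and their incenter-centered circumellipse\<close>

text \<open>If two points were equidistant from the vertices, their difference would be orthogonal
  to both \<open>B - A\<close> and \<open>C - A\<close>, making these parallel.\<close>

lemma circumcenter_eq:
  assumes "\<not> collinear {A, B, C}" "dist P A = r" "dist P B = r" "dist P C = r"
  shows "circumcenter A B C = P"
  unfolding circumcenter_def
proof (rule the_equality)
  show "dist P A = dist P B \<and> dist P B = dist P C" using assms by simp
next
  fix Q assume Q: "dist Q A = dist Q B \<and> dist Q B = dist Q C"
  have orth: "(X - A) \<bullet> (Q - P) = 0" if "dist Q A = dist Q X" "dist P A = dist P X" for X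
  proof -
    have "(norm (Q - A))\<^sup>2 = (norm (Q - X))\<^sup>2" "(norm (P - A))\<^sup>2 = (norm (P - X))\<^sup>2"
      using that by (simp_all add: dist_norm)
    then show ?thesis
      unfolding power2_norm_eq_inner by (simp add: inner_simps inner_commute)
  qed
  show "Q = P"
  proof (rule ccontr)
    assume "Q \<noteq> P"
    have "B \<noteq> A" using assms(1) by auto
    have "(B - A) \<bullet> (Q - P) = 0" "(C - A) \<bullet> (Q - P) = 0" using Q assms orth by metis+
    then obtain t where "C - A = t *\<^sub>R (B - A)"
      using parallel_if_orthogonal_2[of "Q - P" "B - A" "C - A"] \<open>Q \<noteq> P\<close> \<open>B \<noteq> A\<close> by auto
    then have "(B$1 - A$1) * (C$2 - A$2) = (B$2 - A$2) * (C$1 - A$1)"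
      by (simp add: vec_eq_iff forall_2)
    then show False using assms(1) collinear_if_cross_eq_0 by blast
  qed
qed

lemma circumradius_eq:
  assumes "\<not> collinear {A, B, C}" "dist P A = r" "dist P B = r" "dist P C = r"
  shows "circumradius A B C = r"
  unfolding circumradius_def circumcenter_eq[OF assms] by (rule assms)

lemma circumcenter_exists:
  fixes A B C :: "real^2"
  assumes "\<not> collinear {A, B, C}"
  shows "\<exists>P r. dist P A = r \<and> dist P B = r \<and> dist P C = r"
proof -
  define b c where "b = B - A" and "c = C - A"
  define D where "D = 2 * (b$1 * c$2 - b$2 * c$1)"
  \<comment> \<open>Cramer's rule for the system \<open>2 * (b \<bullet> p) = b \<bullet> b\<close>,
    \<open>2 * (c \<bullet> p) = c \<bullet> c\<close>, which says that \<open>p\<close> is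
    equidistant from 0, \<open>b\<close> and \<open>c\<close>.\<close>
  define p :: "real^2" where
    "p = (1 / D) *\<^sub>R vector [c$2 * (b \<bullet> b) - b$2 * (c \<bullet> c), b$1 * (c \<bullet> c) - c$1 * (b \<bullet> b)]"
  have D: "D \<noteq> 0"
    using assms collinear_if_cross_eq_0[of B A C] unfolding D_def b_def c_def by auto
  have "D * (2 * (b \<bullet> p)) = D * (b \<bullet> b)" "D * (2 * (c \<bullet> p)) = D * (c \<bullet> c)"
    using D by (simp_all add: p_def inner_2[of b "vector _"] inner_2[of c "vector _"])
      (simp_all add: D_def algebra_simps)
  then have *: "2 * (b \<bullet> p) = b \<bullet> b" "2 * (c \<bullet> p) = c \<bullet> c" using D by simp_all
  have "dist (A + p) A = norm p" by (simp add: dist_norm)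
  moreover have "dist (A + p) B = norm (p - b)" "dist (A + p) C = norm (p - c)"
    unfolding b_def c_def by (simp_all add: dist_norm algebra_simps)
  moreover have "norm (p - b) = norm p" "norm (p - c) = norm p"
    using * by (simp_all add: norm_eq inner_simps inner_commute)
  ultimately show ?thesis by metis
qed

text \<open>The foot of the perpendicular gives the upper bound; for the lower bound,
  \<open>(x - y) \<bullet> n\<close> is the same for all \<open>y\<close> on the line, and
  Cauchy-Schwarz applies.\<close>

lemma infdist_line_2:
  fixes A B x n :: "real^2"
  assumes "A \<noteq> B" "norm n = 1" "(B - A) \<bullet> n = 0"
  shows "infdist x (affine hull {A, B}) = \<bar>(x - A) \<bullet> n\<bar>"
proof (rule antisym)
  let ?y = "x - ((x - A) \<bullet> n) *\<^sub>R n"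
  have "(?y - A) \<bullet> n = 0"
    using assms(2) by (simp add: norm_eq_1 inner_simps)
  then obtain t where "?y - A = t *\<^sub>R (B - A)"
    using parallel_if_orthogonal_2[of n "B - A" "?y - A"] assms by force
  then have "?y = (1 - t) *\<^sub>R A + t *\<^sub>R B" by (simp add: algebra_simps)
  then have "?y \<in> affine hull {A, B}" unfolding affine_hull_2 mem_Collect_eq
    by (intro exI[of _ "1 - t"] exI[of _ t]) simp
  then show "infdist x (affine hull {A, B}) \<le> \<bar>(x - A) \<bullet> n\<bar>"
    by (rule infdist_le2) (use assms(2) in \<open>simp add: dist_norm\<close>)
next
  have "\<bar>(x - A) \<bullet> n\<bar> \<le> dist x y" if y: "y \<in> affine hull {A, B}" for y
  proof -
    obtain r s where "y = r *\<^sub>R A + s *\<^sub>R B" "r + s = 1" using y unfolding affine_hull_2 by blast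
    moreover have "r = 1 - s" using calculation by simp
    ultimately have "y = A + s *\<^sub>R (B - A)" by (simp add: algebra_simps)
    then have "(x - A) \<bullet> n = (x - y) \<bullet> n" using assms(3) by (simp add: inner_simps)
    also have "\<bar>\<dots>\<bar> \<le> norm (x - y) * norm n" by (rule Cauchy_Schwarz_ineq2)
    finally show ?thesis using assms(2) by (simp add: dist_norm)
  qed
  moreover have "affine hull {A, B} \<noteq> {}" by simp
  ultimately show "\<bar>(x - A) \<bullet> n\<bar> \<le> infdist x (affine hull {A, B})"
    unfolding infdist_notempty[OF \<open>affine hull {A, B} \<noteq> {}\<close>] by (intro cINF_greatest)
qed

section \<open>Unit complex numbers\<close>

lemma unit_cnj: "cmod u = 1 \<Longrightarrow> u * cnj u = 1"
  by (simp add: complex_norm_square[symmetric])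

text \<open>The chord from \<open>u\<^sup>2\<close> to \<open>v\<^sup>2\<close> is perpendicular to
  \<open>u * v\<close>, which points to the midpoint of one of the two arcs. Square roots of the
  vertices thus make the side directions polynomial.\<close>

lemma unit_square_diff:
  assumes "cmod u = 1" "cmod v = 1"
  shows "v\<^sup>2 - u\<^sup>2 = (2 * Im (u * cnj v)) *\<^sub>R (- \<i> * (u * v))"
proof -
  have u: "u * cnj u = 1" and v: "v * cnj v = 1" using assms by (simp_all add: unit_cnj)
  have "v\<^sup>2 - u\<^sup>2 = - (u * cnj v - cnj (u * cnj v)) * (u * v)"
    using u v by (simp add: power2_eq_square algebra_simps)
  also have "u * cnj v - cnj (u * cnj v) = (2 * Im (u * cnj v)) * \<i>"
    by (simp only: complex_diff_cnj)
  finally show ?thesis by (simp add: scaleR_conv_of_real)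
qed

lemma real_multiple_if_cnj_eq:
  assumes "y \<noteq> 0" "cnj (x * cnj y) = x * cnj y"
  shows "\<exists>t. x = t *\<^sub>R y"
proof -
  obtain r where r: "x * cnj y = of_real r"
    using assms(2) by (metis Reals_cases Reals_cnj_iff)
  have "cnj y * y = of_real ((cmod y)\<^sup>2)"
    unfolding complex_norm_square by (rule mult.commute)
  then have "x * of_real ((cmod y)\<^sup>2) = of_real r * y" using r by (metis mult.assoc)
  then have "x = (r / (cmod y)\<^sup>2) *\<^sub>R y"
    using assms(1) by (simp add: scaleR_conv_of_real field_simps)
  then show ?thesis by blast
qed

lemma cmod_unit_sum_3:
  assumes "cmod u = 1" "cmod v = 1" "cmod w = 1"
  shows "(cmod (u + v + w))\<^sup>2 = 3 + 2 * (Re (u * cnj v) + Re (v * cnj w) + Re (w * cnj u))"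
proof -
  have "(cmod (u + v + w))\<^sup>2 = (cmod u)\<^sup>2 + (cmod v)\<^sup>2 + (cmod w)\<^sup>2
      + 2 * (Re (u * cnj v) + Re (v * cnj w) + Re (w * cnj u))"
    unfolding cmod_power2 by (simp add: power2_eq_square algebra_simps)
  then show ?thesis using assms by simp
qed

lemma sgn_scaleR_unit: "0 < t \<Longrightarrow> norm y = 1 \<Longrightarrow> sgn (t *\<^sub>R y) = y"
  for y :: "'a :: real_normed_vector"
  by (simp add: sgn_div_norm)

text \<open>With \<open>c\<^sub>i = cos x\<^sub>i\<close>, \<open>s\<^sub>i = sin x\<^sub>i\<close>, this is \<open>tan (x\<^sub>1/2) * tan (x\<^sub>2/2) > 1\<close> when
  \<open>x\<^sub>1 + x\<^sub>2 > \<pi>\<close>.\<close>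

lemma half_angle_tan_product:
  fixes c1 s1 c2 s2 :: real
  assumes "c1\<^sup>2 + s1\<^sup>2 = 1" "c2\<^sup>2 + s2\<^sup>2 = 1" "s1 > 0" "s2 > 0" "s1 * c2 + c1 * s2 < 0"
  shows "(1 + c1) * (1 + c2) < s1 * s2"
proof -
  have pos: "1 + c > 0" if "c\<^sup>2 + s\<^sup>2 = 1" "s > 0" for c s :: real
  proof -
    have "s\<^sup>2 > 0" using that by simp
    then have "c\<^sup>2 < 1" using that by linarith
    then show ?thesis by (simp add: abs_square_less_1)
  qed
  have c: "1 + c1 > 0" "1 + c2 > 0" using assms pos by blast+
  \<comment> \<open>In terms of the half-angle tangents T1 and T2 this is 2 sin (x1 + x2) = (1 + c1)
    (1 + c2) (T1 + T2) (1 - T1 T2), cleared of denominators.\<close>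
  have "(s1 * c2 + c1 * s2) * (2 * ((1 + c1) * (1 + c2))) =
      (s1 * (1 + c2) + s2 * (1 + c1)) * ((1 + c1) * (1 + c2) - s1 * s2)"
    using assms(1,2) by algebra
  moreover have "(s1 * c2 + c1 * s2) * (2 * ((1 + c1) * (1 + c2))) < 0"
    using assms(5) c by (intro mult_neg_pos) auto
  moreover have "s1 * (1 + c2) + s2 * (1 + c1) > 0" using assms c by (simp add: add_pos_pos)
  ultimately have "(1 + c1) * (1 + c2) - s1 * s2 < 0"
    by (simp add: mult_less_0_iff)
  then show ?thesis by simp
qed

section \<open>A triangle given by square roots of its vertices on the circumcircle\<close>

text \<open>Here \<open>u, v, w\<close> are square roots of the directions from the circumcenter \<open>c\<close> to the vertices.
  Their signs are chosen such that the direction from \<open>A\<close> to \<open>B\<close> is \<open>-\<i>\<sigma>uv\<close>, and cyclically; only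
  then is \<open>c - R (uv + vw + wu)\<close> the incenter and not an excenter.\<close>

locale circle_triangle =
  fixes A B C :: "real^2" and c u v w :: complex and R \<sigma> :: real
  assumes noncollinear: "\<not> collinear {A, B, C}"
    and R_pos: "0 < R"
    and unit: "cmod u = 1" "cmod v = 1" "cmod w = 1"
    and A_eq: "A = vec_of (c + R *\<^sub>R u\<^sup>2)"
    and B_eq: "B = vec_of (c + R *\<^sub>R v\<^sup>2)"
    and C_eq: "C = vec_of (c + R *\<^sub>R w\<^sup>2)"
    and \<sigma>: "\<sigma> = 1 \<or> \<sigma> = -1"
    and sign: "0 < \<sigma> * Im (u * cnj v)" "0 < \<sigma> * Im (v * cnj w)" "0 < \<sigma> * Im (w * cnj u)"
begin

text \<open>Cyclic relabelling preserves all assumptions, so facts proved at \<open>A\<close>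
  transfer to \<open>B\<close> and \<open>C\<close> by interpretation.\<close>

lemma rotate: "circle_triangle B C A c v w u R \<sigma>"
  by unfold_locales (use noncollinear R_pos unit A_eq B_eq C_eq \<sigma> sign in \<open>auto simp: insert_commute\<close>)

text \<open>The chord is a real multiple of \<open>- \<i> * (u * v)\<close>. Inserting
  \<open>\<sigma> * \<sigma> = 1\<close> shifts one factor \<sigma> into the direction and leaves a
  length that is positive by \<open>sign\<close>.\<close>

lemma sgn_AB: "sgn (B - A) = vec_of (- \<i> * \<sigma> * (u * v))"
proof -
  let ?t = "R * (2 * (\<sigma> * Im (u * cnj v)))"
  have \<sigma>2: "\<sigma> * \<sigma> = 1" using \<sigma> by auto
  have "(c + R *\<^sub>R v\<^sup>2) - (c + R *\<^sub>R u\<^sup>2) = R *\<^sub>R (v\<^sup>2 - u\<^sup>2)"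
    by (simp add: scaleR_diff_right)
  also have "\<dots> = (R * (2 * Im (u * cnj v)) * (\<sigma> * \<sigma>)) *\<^sub>R (- \<i> * (u * v))"
    unfolding unit_square_diff[OF unit(1,2)] \<sigma>2 by (simp only: scaleR_scaleR mult_1_right)
  also have "\<dots> = ?t *\<^sub>R (- \<i> * \<sigma> * (u * v))"
    by (simp add: scaleR_conv_of_real)
  finally have "B - A = vec_of (?t *\<^sub>R (- \<i> * \<sigma> * (u * v)))"
    unfolding A_eq B_eq by (simp only: flip: vec_of_diff)
  moreover have "?t > 0" using R_pos sign by simp
  moreover have "cmod (- \<i> * \<sigma> * (u * v)) = 1" using unit \<sigma> by (auto simp: norm_mult)
  ultimately show ?thesis by (simp only: sgn_vec_of sgn_scaleR_unit)
qed

text \<open>The sum of the unit vectors from \<open>A\<close> towards \<open>B\<close> and towards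
  \<open>C\<close>, hence the direction of the internal bisector.\<close>

definition direction :: complex where
  "direction = - \<i> * \<sigma> * (u * (v - w))"

lemma sgn_AC: "sgn (C - A) = vec_of (\<i> * \<sigma> * (u * w))"
proof -
  interpret r: circle_triangle C A B c w u v R \<sigma>
    by (rule circle_triangle.rotate[OF rotate])
  have "sgn (C - A) = - sgn (A - C)" by (simp flip: sgn_minus)
  also have "\<dots> = vec_of (\<i> * \<sigma> * (u * w))"
    unfolding r.sgn_AB by (simp add: vec_eq_iff forall_2 mult.commute)
  finally show ?thesis .
qed

text \<open>An instance of the inscribed angle theorem: the argument of \<open>v * cnj w\<close> is,
  up to sign and supplement, half the central angle over the side \<open>BC\<close>.\<close>

lemma angle_cos: "sgn (B - A) \<bullet> sgn (C - A) = - Re (v * cnj w)"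
proof -
  have "(- \<i> * \<sigma> * (u * v)) * cnj (\<i> * \<sigma> * (u * w)) = - ((\<sigma> * \<sigma>) * (u * cnj u) * (v * cnj w))"
    by (simp add: algebra_simps)
  also have "\<dots> = - (v * cnj w)" using \<sigma> unit by (auto simp: unit_cnj)
  finally show ?thesis unfolding sgn_AB sgn_AC inner_vec_of by simp
qed

lemma bisector_A: "internal_bisector A B C = range (\<lambda>t. A + t *\<^sub>R vec_of direction)"
proof -
  have "sgn (B - A) + sgn (C - A) = vec_of direction"
    unfolding sgn_AB sgn_AC direction_def by (simp add: algebra_simps flip: vec_of_add)
  then show ?thesis unfolding internal_bisector_def by simp
qed

lemma sum_nonzero: "u + v \<noteq> 0"
proof
  assume "u + v = 0"
  then have "v = - u" by (simp add: eq_neg_iff_add_eq_0 add.commute)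
  then show False using sign(1) unit(1) by (simp add: unit_cnj)
qed

definition center :: complex where
  "center = c - R *\<^sub>R (u * v + v * w + w * u)"

lemma center_diff: "vec_of center - A = vec_of (- (R *\<^sub>R ((u + v) * (u + w))))"
proof -
  have "center - (c + R *\<^sub>R u\<^sup>2) = - (R *\<^sub>R ((u + v) * (u + w)))"
    unfolding center_def by (simp add: algebra_simps power2_eq_square scaleR_conv_of_real)
  then show ?thesis unfolding A_eq by (simp only: flip: vec_of_diff)
qed

lemma direction_nonzero: "direction \<noteq> 0"
proof -
  have "v \<noteq> w" using sign(2) unit by (auto simp: unit_cnj)
  then show ?thesis using unit \<sigma> unfolding direction_def by auto
qed

text \<open>By \<open>center_diff\<close> it suffices that \<open>(u + v) * (u + w)\<close> divided
  by \<open>direction\<close> is real, which is tested by conjugation. That \<open>t\<close> is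
  nonzero is used later to keep the center off the side lines.\<close>

lemma center_direction: "\<exists>t. t \<noteq> 0 \<and> vec_of center - A = t *\<^sub>R vec_of direction"
proof -
  let ?x = "- (R *\<^sub>R ((u + v) * (u + w)))"
  define q where "q = (u + v) * (u + w) * cnj (u * (v - w))"
  \<comment> \<open>The terms are grouped so that each product of a root with its conjugate is
    visible and can be replaced by 1; what remains is a sum of differences of conjugates, so
    \<open>q\<close> is purely imaginary.\<close>
  have "q = (u * cnj u) * ((u + v + w) * (cnj v - cnj w)) + (v * cnj v) * (w * cnj u) - (w * cnj w) * (v * cnj u)"
    unfolding q_def by (simp add: algebra_simps)
  also have "\<dots> = u * cnj v + v * cnj v + w * cnj v - u * cnj w - v * cnj w - w * cnj w + w * cnj u - v * cnj u"
    unfolding unit[THEN unit_cnj] by (simp add: algebra_simps unit[THEN unit_cnj])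
  also have "\<dots> = (u * cnj v - v * cnj u) + (w * cnj v - v * cnj w) + (w * cnj u - u * cnj w)"
    unfolding unit[THEN unit_cnj] by simp
  finally have q: "cnj q = - q" by (simp add: mult.commute)
  have x: "?x * cnj direction = - (of_real (R * \<sigma>) * \<i> * q)"
    unfolding direction_def q_def by (simp add: scaleR_conv_of_real algebra_simps)
  have "cnj (?x * cnj direction) = ?x * cnj direction"
    unfolding x by (simp add: q)
  then obtain t where t: "?x = t *\<^sub>R direction"
    using real_multiple_if_cnj_eq[OF direction_nonzero] by blast
  interpret r: circle_triangle C A B c w u v R \<sigma>
    by (rule circle_triangle.rotate[OF rotate])
  have "?x \<noteq> 0" using sum_nonzero r.sum_nonzero R_pos by (simp add: add.commute)
  then have "t \<noteq> 0" using t by auto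
  then show ?thesis unfolding center_diff t vec_of_scaleR by blast
qed

text \<open>This is the ratio d/R, by \<open>dist_incenter_circumcenter\<close>, and also the
  modulus of the coefficient kappa of the ellipse map. It later turns out to be the billiard
  invariant k.\<close>

definition root_sum :: real where
  "root_sum = cmod (u + v + w)"

lemma root_sum_nonneg: "0 \<le> root_sum"
  unfolding root_sum_def by simp

lemma root_sum_eq: "root_sum\<^sup>2 = 3 + 2 * (Re (u * cnj v) + Re (v * cnj w) + Re (w * cnj u))"
  unfolding root_sum_def by (rule cmod_unit_sum_3[OF unit])

text \<open>The cross product of two bisector directions is a sum of three sines, which
  \<open>sign\<close> makes all of the sign \<sigma>, so nothing cancels.\<close>

lemma cross2_direction:
  "cross2 (vec_of direction) (vec_of (circle_triangle.direction v w u \<sigma>)) \<noteq> 0"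
proof -
  interpret r: circle_triangle B C A c v w u R \<sigma> by (rule rotate)
  have "cnj direction * r.direction
      = (\<sigma> * \<sigma>) * (cnj u * (cnj v - cnj w) * (v * (w - u)))"
    unfolding direction_def r.direction_def by (simp add: algebra_simps)
  also have "\<dots> = cnj u * (cnj v - cnj w) * (v * (w - u))"
    using \<sigma> by auto
  also have "\<dots> = (v * cnj v) * (w * cnj u) - (v * cnj v) * (u * cnj u) - (w * cnj w) * (v * cnj u)
      + (u * cnj u) * (v * cnj w)"
    by (simp add: algebra_simps)
  also have "\<dots> = w * cnj u - 1 - v * cnj u + v * cnj w"
    by (simp only: unit[THEN unit_cnj]) simp
  finally have "cross2 (vec_of direction) (vec_of r.direction) =
      Im (w * cnj u) + Im (u * cnj v) + Im (v * cnj w)"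
    unfolding cross2_vec_of by simp
  moreover have "0 < \<sigma> * (Im (w * cnj u) + Im (u * cnj v) + Im (v * cnj w))"
    using sign unfolding distrib_left by linarith
  ultimately show ?thesis by auto
qed

lemma center_rotate: "circle_triangle.center c v w u R = center"
proof -
  interpret r: circle_triangle B C A c v w u R \<sigma> by (rule rotate)
  show ?thesis unfolding center_def r.center_def by (simp add: add_ac)
qed

text \<open>Places the center off the line \<open>AB\<close>, as \<open>ellipse_unique\<close>
  demands: both vectors are nonzero multiples of the bisector directions, which are not
  parallel.\<close>

lemma cross2_center: "cross2 (A - vec_of center) (B - vec_of center) \<noteq> 0"
proof -
  interpret r: circle_triangle B C A c v w u R \<sigma> by (rule rotate)
  obtain t where t: "t \<noteq> 0" "vec_of center - A = t *\<^sub>R vec_of direction"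
    using center_direction by blast
  obtain s where s: "s \<noteq> 0" "vec_of center - B = s *\<^sub>R vec_of r.direction"
    using r.center_direction unfolding center_rotate by blast
  have "cross2 (A - vec_of center) (B - vec_of center)
      = cross2 (vec_of center - A) (vec_of center - B)"
    unfolding cross2_def by (simp add: algebra_simps)
  also have "\<dots> = t * s * cross2 (vec_of direction) (vec_of r.direction)"
    unfolding t(2) s(2) cross2_def by (simp add: algebra_simps)
  finally show ?thesis using cross2_direction t s by simp
qed

lemma incenter_eq: "incenter A B C = vec_of center"
  unfolding incenter_def
proof (rule the_equality)
  interpret r: circle_triangle B C A c v w u R \<sigma> by (rule rotate)
  interpret r2: circle_triangle C A B c w u v R \<sigma> by (rule r.rotate)
  obtain t where t: "vec_of center - A = t *\<^sub>R vec_of direction"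
    using center_direction by blast
  obtain s where s: "vec_of center - B = s *\<^sub>R vec_of r.direction"
    using r.center_direction unfolding center_rotate by blast
  obtain q where q: "vec_of center - C = q *\<^sub>R vec_of r2.direction"
    using r2.center_direction unfolding r.center_rotate center_rotate by blast
  show "vec_of center \<in> internal_bisector A B C \<and> vec_of center \<in> internal_bisector B C A \<and>
      vec_of center \<in> internal_bisector C A B"
    unfolding bisector_A r.bisector_A r2.bisector_A image_iff
    using t s q by (metis (no_types, lifting) UNIV_I add.commute diff_add_cancel)
  fix I assume I: "I \<in> internal_bisector A B C \<and> I \<in> internal_bisector B C A \<and>
      I \<in> internal_bisector C A B"
  then obtain t' s' where "I = A + t' *\<^sub>R vec_of direction" "I = B + s' *\<^sub>R vec_of r.direction"
    unfolding bisector_A r.bisector_A r2.bisector_A by blast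
  then have "I - A = t' *\<^sub>R vec_of direction" "I - B = s' *\<^sub>R vec_of r.direction"
    by (metis add_diff_cancel_left')+
  then show "I = vec_of center" using lines_meet_once[OF cross2_direction t s] by blast
qed

lemma dist_circumcenter: "dist (vec_of c) A = R" "dist (vec_of c) B = R" "dist (vec_of c) C = R"
  using unit R_pos unfolding A_eq B_eq C_eq by (simp_all add: dist_vec_of norm_power)

lemma circumcenter_eq: "circumcenter A B C = vec_of c"
  using noncollinear dist_circumcenter by (rule circumcenter_eq)

lemma circumradius_eq: "circumradius A B C = R"
  unfolding circumradius_def circumcenter_eq by (rule dist_circumcenter)

text \<open>Geometrically d < R. The product of \<open>u * cnj v\<close>, \<open>v * cnj w\<close>
  and \<open>w * cnj u\<close> is 1, so the third argument is minus the sum of the other two. The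
  claim becomes 1 + cos x1 + cos x2 + cos (x1 + x2) < 0, a rearrangement of
  \<open>half_angle_tan_product\<close>.\<close>

lemma root_sum_less_1: "root_sum < 1"
proof -
  define c1 s1 c2 s2 where "c1 = Re (u * cnj v)" and "s1 = \<sigma> * Im (u * cnj v)"
    and "c2 = Re (v * cnj w)" and "s2 = \<sigma> * Im (v * cnj w)"
  have \<sigma>2: "\<sigma>\<^sup>2 = 1" using \<sigma> by auto
  have "(cmod (u * cnj v))\<^sup>2 = 1" "(cmod (v * cnj w))\<^sup>2 = 1" using unit by (simp_all add: norm_mult)
  then have 1: "c1\<^sup>2 + s1\<^sup>2 = 1" "c2\<^sup>2 + s2\<^sup>2 = 1"
    unfolding c1_def s1_def c2_def s2_def power_mult_distrib cmod_power2 \<sigma>2 by simp_all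
  have "(u * cnj v) * (v * cnj w) = (v * cnj v) * cnj (w * cnj u)" by (simp add: algebra_simps)
  then have P: "cnj (w * cnj u) = (u * cnj v) * (v * cnj w)"
    unfolding unit(2)[THEN unit_cnj] mult_1_left by (rule sym)
  have "Re (w * cnj u) = Re (cnj (w * cnj u))" "Im (w * cnj u) = - Im (cnj (w * cnj u))"
    by simp_all
  then have Q: "Re (w * cnj u) = c1 * c2 - s1 * s2" "\<sigma> * Im (w * cnj u) = - (s1 * c2 + c1 * s2)"
    unfolding P c1_def c2_def s1_def s2_def using \<sigma> by (auto simp: algebra_simps)
  have "(1 + c1) * (1 + c2) < s1 * s2"
  proof (rule half_angle_tan_product[OF 1])
    show "s1 > 0" "s2 > 0" using sign unfolding s1_def s2_def by simp_all
    show "s1 * c2 + c1 * s2 < 0" using sign(3) Q by linarith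
  qed
  then have "1 + c1 + c2 + Re (w * cnj u) < 0" unfolding Q by (simp add: algebra_simps)
  moreover have "root_sum\<^sup>2 = 3 + 2 * (c1 + c2 + Re (w * cnj u))"
    unfolding c1_def c2_def by (rule root_sum_eq)
  ultimately have "root_sum\<^sup>2 < 1" by argo
  then show ?thesis using power2_less_imp_less[of root_sum 1] by simp
qed

text \<open>\<open>u * v\<close> is a unit normal of \<open>AB\<close>, so the distance of the
  center from this side is an inner product. With \<open>root_sum\<close> as d/R the result is
  Euler's relation between r, R and d.\<close>

lemma inradius_eq: "inradius A B C = R * (1 - root_sum\<^sup>2) / 2"
proof -
  have "A \<noteq> B" using noncollinear by auto
  moreover have n: "norm (vec_of (u * v)) = 1" using unit by (simp add: norm_mult)
  moreover have "(B - A) \<bullet> vec_of (u * v) = 0"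
  proof -
    have "B - A = norm (B - A) *\<^sub>R sgn (B - A)" by (cases "A = B") (simp_all add: sgn_div_norm)
    moreover have "sgn (B - A) \<bullet> vec_of (u * v) = 0"
    proof -
      have "(- \<i> * \<sigma> * (u * v)) * cnj (u * v) = - (\<i> * \<sigma>) * ((u * cnj u) * (v * cnj v))"
        by (simp only: complex_cnj_mult mult_minus_left mult_ac)
      also have "\<dots> = - (\<i> * \<sigma>)" using unit by (simp only: unit_cnj) simp
      finally have eq: "(- \<i> * \<sigma> * (u * v)) * cnj (u * v) = - (\<i> * \<sigma>)" .
      show ?thesis unfolding sgn_AB inner_vec_of eq by simp
    qed
    ultimately show ?thesis by (metis inner_scaleR_left mult_zero_right)
  qed
  ultimately have "inradius A B C = \<bar>(vec_of center - A) \<bullet> vec_of (u * v)\<bar>"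
    unfolding inradius_def incenter_eq by (rule infdist_line_2)
  also have "(vec_of center - A) \<bullet> vec_of (u * v) = - R * Re ((u + v) * (u + w) * cnj (u * v))"
    unfolding center_diff inner_vec_of by (simp add: scaleR_conv_of_real algebra_simps)
  also have "(u + v) * (u + w) * cnj (u * v) = (u * cnj u) * (u * cnj v) + (u * cnj u) * (w * cnj v)
      + (u * cnj u) * (v * cnj v) + (v * cnj v) * (w * cnj u)"
    by (simp add: algebra_simps)
  also have "\<dots> = u * cnj v + w * cnj v + 1 + w * cnj u"
    by (simp only: unit[THEN unit_cnj]) simp
  also have "Re \<dots> = (root_sum\<^sup>2 - 1) / 2" unfolding root_sum_eq by simp
  also have "- R * ((root_sum\<^sup>2 - 1) / 2) = R * (1 - root_sum\<^sup>2) / 2" by (simp add: algebra_simps)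
  also have "\<bar>\<dots>\<bar> = R * (1 - root_sum\<^sup>2) / 2"
  proof -
    have "root_sum\<^sup>2 \<le> 1" using root_sum_nonneg root_sum_less_1 by (simp add: power_le_one)
    then show ?thesis using R_pos by simp
  qed
  finally show ?thesis .
qed

text \<open>For unit numbers the second elementary symmetric function is the third one times the
  conjugate of the first, so it has modulus \<open>root_sum\<close>.\<close>

lemma dist_incenter_circumcenter: "dist (incenter A B C) (circumcenter A B C) = R * root_sum"
proof -
  have "u * v + v * w + w * u = (u * cnj u) * (v * w) + (v * cnj v) * (w * u) + (w * cnj w) * (u * v)"
    by (simp only: unit[THEN unit_cnj]) (simp add: add_ac)
  also have "\<dots> = u * v * w * cnj (u + v + w)" by (simp add: algebra_simps)
  finally have "cmod (u * v + v * w + w * u) = root_sum"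
    unfolding root_sum_def using unit by (simp add: norm_mult del: complex_cnj_add)
  then show ?thesis
    unfolding incenter_eq circumcenter_eq dist_vec_of center_def using R_pos by simp
qed

lemma incenter_circumellipse:
  "is_ellipse (incenter_circumellipse A B C) (incenter A B C) (R * (1 + root_sum)) (R * (1 - root_sum))"
proof -
  let ?k = "u * v * w * (u + v + w)" and ?p = "R * (1 + root_sum)" and ?q = "R * (1 - root_sum)"
  \<comment> \<open>The major axis points along a square root of kappa/|kappa|. For kappa = 0 the
    ellipse is a circle and any unit direction serves, here 1.\<close>
  define g where "g = (if root_sum = 0 then 1 else csqrt (?k / root_sum))"
  have "cmod ?k = root_sum" unfolding root_sum_def using unit by (simp add: norm_mult)
  then have g: "cmod g = 1" "?k = root_sum * g\<^sup>2"
    unfolding g_def using root_sum_nonneg by (auto simp: norm_divide)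
  define E where "E = {vec_of center + x *\<^sub>R vec_of g + y *\<^sub>R vec_of (\<i> * g) | x y. x\<^sup>2 / ?p\<^sup>2 + y\<^sup>2 / ?q\<^sup>2 = 1}"
  have s: "0 \<le> root_sum" "root_sum < 1" using root_sum_nonneg root_sum_less_1 by simp_all
  have pq: "0 < ?q" "?q \<le> ?p" using s R_pos by simp_all
  have E: "is_ellipse E (vec_of center) ?p ?q"
    unfolding is_ellipse_def
  proof (intro conjI exI)
    show "0 < ?q" "?q \<le> ?p" using pq by blast+
    show "norm (vec_of g) = 1" "norm (vec_of (\<i> * g)) = 1" using g by (simp_all add: norm_mult)
    show "vec_of g \<bullet> vec_of (\<i> * g) = 0" by (simp add: inner_vec_of)
  qed (rule E_def)
  \<comment> \<open>In the frame rotated by \<open>g\<close>, with \<open>h = g * m\<close>, the map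
    becomes \<open>m + root_sum * cnj m\<close>: it stretches the real part by
    \<open>1 + root_sum\<close> and shrinks the imaginary part by \<open>1 - root_sum\<close>. The
    vertices arise from \<open>h\<close> being \<open>v * w\<close>, \<open>w * u\<close> and
    \<open>u * v\<close>.\<close>
  have vertex: "P \<in> E" if h: "cmod h = 1" and P: "P = vec_of (center + R *\<^sub>R (h + ?k * cnj h))" for P h
  proof -
    define m where "m = cnj g * h"
    have gg: "g * cnj g = 1" using g by (simp add: unit_cnj)
    have "g * (m + root_sum * cnj m) = (g * cnj g) * h + root_sum * g\<^sup>2 * cnj h"
      unfolding m_def by (simp add: algebra_simps power2_eq_square)
    then have "h + ?k * cnj h = g * (m + root_sum * cnj m)"
      unfolding g(2) gg by simp
    also have "m + root_sum * cnj m = (1 + root_sum) *\<^sub>R (of_real (Re m)) + (1 - root_sum) *\<^sub>R (Im m * \<i>)"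
      by (simp add: complex_eq_iff algebra_simps)
    finally have hk: "h + ?k * cnj h = g * ((1 + root_sum) *\<^sub>R (of_real (Re m)) + (1 - root_sum) *\<^sub>R (Im m * \<i>))" .
    have "center + R *\<^sub>R (h + ?k * cnj h) = center + (?p * Re m) *\<^sub>R g + (?q * Im m) *\<^sub>R (\<i> * g)"
      unfolding hk by (simp add: scaleR_conv_of_real algebra_simps)
    moreover have "(?p * Re m)\<^sup>2 / ?p\<^sup>2 + (?q * Im m)\<^sup>2 / ?q\<^sup>2 = 1"
    proof -
      have "(Re m)\<^sup>2 + (Im m)\<^sup>2 = 1"
        unfolding cmod_power2[symmetric] m_def using g h by (simp add: norm_mult)
      moreover have "?p \<noteq> 0" "?q \<noteq> 0" using pq by linarith+
      ultimately show ?thesis unfolding power_mult_distrib[of _ "Re m"] power_mult_distrib[of _ "Im m"]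
        by simp
    qed
    ultimately show ?thesis unfolding P E_def mem_Collect_eq
      by (intro exI[of _ "?p * Re m"] exI[of _ "?q * Im m"] conjI) (simp_all only: vec_of_add vec_of_scaleR)
  qed
  have unit': "cmod (v * w) = 1" "cmod (w * u) = 1" "cmod (u * v) = 1" using unit by (simp_all add: norm_mult)
  have "?k * cnj (v * w) = (v * cnj v) * (w * cnj w) * (u * (u + v + w))"
    "?k * cnj (w * u) = (w * cnj w) * (u * cnj u) * (v * (u + v + w))"
    "?k * cnj (u * v) = (u * cnj u) * (v * cnj v) * (w * (u + v + w))"
    by (simp_all add: mult_ac)
  then have k: "?k * cnj (v * w) = u * (u + v + w)" "?k * cnj (w * u) = v * (u + v + w)"
    "?k * cnj (u * v) = w * (u + v + w)"
    by (simp_all only: unit[THEN unit_cnj] mult_1_left)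
  have "A \<in> E"
    by (rule vertex[OF unit'(1)])
       (unfold k A_eq center_def, simp add: algebra_simps power2_eq_square scaleR_conv_of_real)
  moreover have "B \<in> E"
    by (rule vertex[OF unit'(2)])
       (unfold k B_eq center_def, simp add: algebra_simps power2_eq_square scaleR_conv_of_real)
  moreover have "C \<in> E"
    by (rule vertex[OF unit'(3)])
       (unfold k C_eq center_def, simp add: algebra_simps power2_eq_square scaleR_conv_of_real)
  ultimately have ABC: "{A, B, C} \<subseteq> E" by blast
  interpret r: circle_triangle B C A c v w u R \<sigma> by (rule rotate)
  interpret r2: circle_triangle C A B c w u v R \<sigma> by (rule r.rotate)
  have "incenter_circumellipse A B C = E"
    unfolding incenter_circumellipse_def circumellipse_def incenter_eq
  proof (rule the_equality)
    show "(\<exists>p q. is_ellipse E (vec_of center) p q) \<and> {A, B, C} \<subseteq> E" using E ABC by blast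
    fix E' assume E': "(\<exists>p q. is_ellipse E' (vec_of center) p q) \<and> {A, B, C} \<subseteq> E'"
    then obtain p q where "is_ellipse E' (vec_of center) p q" by blast
    then show "E' = E"
      using E' ellipse_unique[OF _ _ E ABC cross2_center r.cross2_center[unfolded center_rotate]
        r2.cross2_center[unfolded r.center_rotate center_rotate]] by blast
  qed
  then show ?thesis using E by (simp add: incenter_eq)
qed

end

section \<open>Arbitrary triangles\<close>

lemma circle_triangle_exists:
  assumes "\<not> collinear {A, B, C}"
  shows "\<exists>c u v w R \<sigma>. circle_triangle A B C c u v w R \<sigma>"
proof -
  obtain P R where P: "dist P A = R" "dist P B = R" "dist P C = R"
    using circumcenter_exists[OF assms] by blast
  obtain c where c: "P = vec_of c" using vec_of_surj by blast
  have ne: "A \<noteq> B" "B \<noteq> C" "C \<noteq> A" using assms by (auto simp: insert_commute)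
  have R: "0 < R"
  proof (rule ccontr)
    assume "\<not> 0 < R"
    then have "R = 0" using P(1) zero_le_dist[of P A] by linarith
    then show False using P ne by simp
  qed
  have root: "\<exists>u. cmod u = 1 \<and> X = vec_of (c + R *\<^sub>R u\<^sup>2)" if "dist P X = R" for X
  proof -
    obtain x where x: "X = vec_of x" using vec_of_surj by blast
    have "cmod (c - x) = R" using that unfolding c x dist_vec_of .
    then have "cmod (csqrt ((x - c) / R)) = 1"
      using R by (simp add: norm_divide norm_minus_commute)
    moreover have "X = vec_of (c + R *\<^sub>R (csqrt ((x - c) / R))\<^sup>2)"
      using R x by (simp add: scaleR_conv_of_real)
    ultimately show ?thesis by blast
  qed
  obtain u where u: "cmod u = 1" "A = vec_of (c + R *\<^sub>R u\<^sup>2)" using root P by blast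
  obtain v where v: "cmod v = 1" "B = vec_of (c + R *\<^sub>R v\<^sup>2)" using root P by blast
  obtain w where w: "cmod w = 1" "C = vec_of (c + R *\<^sub>R w\<^sup>2)" using root P by blast
  let ?x = "Im (u * cnj v)" and ?y = "Im (v * cnj w)" and ?z = "Im (w * cnj u)"
  have "?x \<noteq> 0" "?y \<noteq> 0" "?z \<noteq> 0"
    using ne unit_square_diff[OF u(1) v(1)] unit_square_diff[OF v(1) w(1)] unit_square_diff[OF w(1) u(1)]
    unfolding u(2) v(2) w(2) by auto
  \<comment> \<open>Negating one root flips two of the three signs, so their product is independent
    of the choice of roots; once all three signs equal \<sigma>, it is the cube of \<sigma>, which
    is \<sigma>. Keeping \<open>v\<close>, the signs of \<open>u\<close> and \<open>w\<close> are
    then forced by the first two conditions, and the third follows.\<close>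
  define \<sigma> where "\<sigma> = sgn ?x * sgn ?y * sgn ?z"
  let ?u = "(\<sigma> * sgn ?x) *\<^sub>R u" and ?w = "(\<sigma> * sgn ?y) *\<^sub>R w"
  have s: "sgn ?x = 1 \<or> sgn ?x = -1" "sgn ?y = 1 \<or> sgn ?y = -1" "sgn ?z = 1 \<or> sgn ?z = -1"
    using \<open>?x \<noteq> 0\<close> \<open>?y \<noteq> 0\<close> \<open>?z \<noteq> 0\<close> by (auto simp: sgn_if)
  have "circle_triangle A B C c ?u v ?w R \<sigma>"
  proof
    show "\<not> collinear {A, B, C}" "0 < R" "cmod v = 1" "B = vec_of (c + R *\<^sub>R v\<^sup>2)"
      by fact+
    show "\<sigma> = 1 \<or> \<sigma> = - 1" using s unfolding \<sigma>_def by auto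
    then show "cmod ?u = 1" "cmod ?w = 1" "A = vec_of (c + R *\<^sub>R ?u\<^sup>2)" "C = vec_of (c + R *\<^sub>R ?w\<^sup>2)"
      using s u w by auto
    have sq: "\<sigma> * \<sigma> = 1" using s unfolding \<sigma>_def by auto
    have "\<sigma> * Im (?u * cnj v) = (\<sigma> * \<sigma>) * (sgn ?x * ?x)"
      "\<sigma> * Im (v * cnj ?w) = (\<sigma> * \<sigma>) * (sgn ?y * ?y)"
      "\<sigma> * Im (?w * cnj ?u) = (\<sigma> * \<sigma>) * (sgn ?x * sgn ?y * \<sigma> * ?z)"
      by (simp_all add: algebra_simps)
    moreover have "0 < sgn t * t" if "t \<noteq> 0" for t :: real using that by (simp add: sgn_if)
    moreover have "sgn ?x * sgn ?y * \<sigma> = sgn ?z" using s unfolding \<sigma>_def by auto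
    ultimately show "0 < \<sigma> * Im (?u * cnj v)" "0 < \<sigma> * Im (v * cnj ?w)" "0 < \<sigma> * Im (?w * cnj ?u)"
      using \<open>?x \<noteq> 0\<close> \<open>?y \<noteq> 0\<close> \<open>?z \<noteq> 0\<close> unfolding sq mult_1_left by presburger+
  qed
  then show ?thesis by blast
qed

text \<open>Exports the results without the auxiliary roots. The last fact is the classical cos A +
  cos B + cos C = 1 + r/R, which will be compared with the billiard.\<close>

lemma triangle_incenter_circumellipse:
  assumes "\<not> collinear {A, B, C}"
  obtains R s where "0 < R" "0 \<le> s" "s < 1"
    "circumradius A B C = R" "inradius A B C = R * (1 - s\<^sup>2) / 2"
    "dist (incenter A B C) (circumcenter A B C) = R * s"
    "major_semiaxis (incenter_circumellipse A B C) = R * (1 + s)"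
    "minor_semiaxis (incenter_circumellipse A B C) = R * (1 - s)"
    "sgn (B - A) \<bullet> sgn (C - A) + sgn (C - B) \<bullet> sgn (A - B) + sgn (A - C) \<bullet> sgn (B - C) = (3 - s\<^sup>2) / 2"
proof -
  obtain c u v w R \<sigma> where "circle_triangle A B C c u v w R \<sigma>"
    using circle_triangle_exists[OF assms] by blast
  then interpret circle_triangle A B C c u v w R \<sigma> .
  interpret r: circle_triangle B C A c v w u R \<sigma> by (rule rotate)
  interpret r2: circle_triangle C A B c w u v R \<sigma> by (rule r.rotate)
  show thesis
  proof (rule that[of R root_sum])
    show "sgn (B - A) \<bullet> sgn (C - A) + sgn (C - B) \<bullet> sgn (A - B) + sgn (A - C) \<bullet> sgn (B - C)
        = (3 - root_sum\<^sup>2) / 2"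
      unfolding angle_cos r.angle_cos r2.angle_cos root_sum_eq by simp
  qed (use R_pos root_sum_nonneg root_sum_less_1 circumradius_eq inradius_eq dist_incenter_circumcenter
      semiaxes_eq[OF incenter_circumellipse] in auto)
qed

subsection \<open>Billiard triangles\<close>

definition gradient :: "real \<Rightarrow> real \<Rightarrow> real^2 \<Rightarrow> real^2" where
  "gradient a b p = vector [p$1 / a\<^sup>2, p$2 / b\<^sup>2]"

definition to_circle :: "real \<Rightarrow> real \<Rightarrow> real^2 \<Rightarrow> complex" where
  "to_circle a b p = Complex (p$1 / a) (p$2 / b)"

lemma billiard_normal_eq: "billiard_normal a b p = range (\<lambda>t. p + t *\<^sub>R gradient a b p)"
  unfolding billiard_normal_def gradient_def ..

text \<open>The bridge between the two pictures: pairing with the normal of the ellipse is the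
  Euclidean inner product on the unit circle.\<close>

lemma gradient_inner: "gradient a b p \<bullet> q = Re (to_circle a b p * cnj (to_circle a b q))"
  by (simp add: gradient_def to_circle_def inner_2[of "vector _"] power2_eq_square)

lemma norm_to_circle: "p \<in> elliptic_billiard a b \<longleftrightarrow> cmod (to_circle a b p) = 1"
  by (simp add: elliptic_billiard_def to_circle_def cmod_def power_divide)

lemma gradient_inner_self: "p \<in> elliptic_billiard a b \<Longrightarrow> gradient a b p \<bullet> p = 1"
  unfolding gradient_inner norm_to_circle by (simp only: unit_cnj) simp

lemma to_circle_inj: "a \<noteq> 0 \<Longrightarrow> b \<noteq> 0 \<Longrightarrow> to_circle a b p = to_circle a b q \<longleftrightarrow> p = q"
  by (auto simp: to_circle_def vec_eq_iff forall_2)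

lemma sgn_inner_self: "sgn x \<bullet> x = norm x" for x :: "'a :: real_inner"
  by (cases "x = 0") (simp_all add: sgn_div_norm inner_commute power2_norm_eq_inner[symmetric] power2_eq_square)

lemma inner_unit_less_1:
  fixes z w :: complex
  assumes "cmod z = 1" "cmod w = 1" "z \<noteq> w"
  shows "Re (z * cnj w) < 1"
proof -
  have "(cmod (z - w))\<^sup>2 = (cmod z)\<^sup>2 + (cmod w)\<^sup>2 - 2 * Re (z * cnj w)"
    unfolding cmod_power2 by (simp add: power2_eq_square algebra_simps)
  moreover have "(cmod (z - w))\<^sup>2 > 0" using assms(3) by simp
  ultimately show ?thesis using assms(1,2) by simp
qed

text \<open>Both sides of the chord equation are nonnegative, so squaring is reversible. The squared
  length contains the positive factor 1 - c, and cancelling it leaves a relation linear in c and m.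
  The forward direction yields the invariant, the backward one constructs billiard
  triangles.\<close>

lemma chord_iff:
  assumes "a \<noteq> 0" "b \<noteq> 0" "0 < J" "p \<in> elliptic_billiard a b" "q \<in> elliptic_billiard a b" "p \<noteq> q"
  shows "1 - Re (to_circle a b p * cnj (to_circle a b q)) = J * dist p q \<longleftrightarrow>
    Re (to_circle a b p * cnj (to_circle a b q)) - J\<^sup>2 * (a\<^sup>2 - b\<^sup>2) * Re (to_circle a b p * to_circle a b q)
      = 1 - J\<^sup>2 * (a\<^sup>2 + b\<^sup>2)"
proof -
  define x y x' y' where "x = p$1 / a" and "y = p$2 / b" and "x' = q$1 / a" and "y' = q$2 / b"
  define c m where "c = x * x' + y * y'" and "m = x * x' - y * y'"
  have circ: "x\<^sup>2 + y\<^sup>2 = 1" "x'\<^sup>2 + y'\<^sup>2 = 1"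
    using assms(4,5) unfolding x_def y_def x'_def y'_def by (simp_all add: elliptic_billiard_def power_divide)
  have Re: "Re (to_circle a b p * cnj (to_circle a b q)) = c" "Re (to_circle a b p * to_circle a b q) = m"
    unfolding c_def m_def x_def y_def x'_def y'_def to_circle_def by simp_all
  have c: "c < 1" unfolding Re(1)[symmetric]
    using inner_unit_less_1 assms to_circle_inj norm_to_circle by metis
  \<comment> \<open>Sum-to-product formulas: if the two points have angles s and t, then c = cos (s
    - t) and m = cos (s + t).\<close>
  have sq: "(x - x')\<^sup>2 = (1 - c) * (1 - m)" "(y - y')\<^sup>2 = (1 - c) * (1 + m)"
    using circ unfolding c_def m_def by algebra+
  have "p - q = vector [a * (x - x'), b * (y - y')]"
    unfolding x_def y_def x'_def y'_def using assms(1,2) by (simp add: vec_eq_iff forall_2 right_diff_distrib)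
  then have "(dist p q)\<^sup>2 = a\<^sup>2 * (x - x')\<^sup>2 + b\<^sup>2 * (y - y')\<^sup>2"
    unfolding dist_norm power2_norm_eq_inner inner_2
    by (simp add: power2_eq_square algebra_simps)
  then have d: "(dist p q)\<^sup>2 = (1 - c) * (a\<^sup>2 * (1 - m) + b\<^sup>2 * (1 + m))"
    unfolding sq by (simp add: algebra_simps)
  have "1 - c = J * dist p q \<longleftrightarrow> (1 - c)\<^sup>2 = (J * dist p q)\<^sup>2"
    using c assms(3) by (simp add: power2_eq_iff_nonneg)
  also have "\<dots> \<longleftrightarrow> (1 - c) * (1 - c) = (1 - c) * (J\<^sup>2 * (a\<^sup>2 * (1 - m) + b\<^sup>2 * (1 + m)))"
    unfolding power_mult_distrib d by (simp add: power2_eq_square mult_ac)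
  also have "\<dots> \<longleftrightarrow> 1 - c = J\<^sup>2 * (a\<^sup>2 * (1 - m) + b\<^sup>2 * (1 + m))"
    using c by simp
  also have "\<dots> \<longleftrightarrow> c - J\<^sup>2 * (a\<^sup>2 - b\<^sup>2) * m = 1 - J\<^sup>2 * (a\<^sup>2 + b\<^sup>2)"
    by (auto simp: algebra_simps)
  finally show ?thesis unfolding Re .
qed

text \<open>The pairwise relation says that the points are mutually conjugate with respect to a
  fixed conic, so that each two of them are the roots of a quadratic equation given by the third.\<close>

lemma conjugate_triple_on_circle:
  fixes z1 z2 z3 :: complex and k K :: real
  assumes unit: "cmod z1 = 1" "cmod z2 = 1" "cmod z3 = 1"
    and ne: "z1 \<noteq> z2" "z2 \<noteq> z3" "z3 \<noteq> z1"
    and conj: "Re (z1 * cnj z2) - k * Re (z1 * z2) = K" "Re (z2 * cnj z3) - k * Re (z2 * z3) = K"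
      "Re (z3 * cnj z1) - k * Re (z3 * z1) = K"
    and k: "0 < k"
  shows "cmod (z1 + z2 + z3) = k" "1 + 2 * K = k\<^sup>2"
proof -
  \<comment> \<open>Doubling the real parts, writing them with conjugates and multiplying by
    \<open>z * w\<close> gives a polynomial relation.\<close>
  have pair: "z\<^sup>2 + w\<^sup>2 - k * (z\<^sup>2 * w\<^sup>2 + 1) = 2 * K * (z * w)"
    if "cmod z = 1" "cmod w = 1" "Re (z * cnj w) - k * Re (z * w) = K" for z w :: complex
  proof -
    have zw: "z * cnj z = 1" "w * cnj w = 1" using that by (simp_all add: unit_cnj)
    have "2 * complex_of_real K = of_real (2 * Re (z * cnj w)) - complex_of_real k * of_real (2 * Re (z * w))"
      unfolding that(3)[symmetric] by simp
    also have "\<dots> = (z * cnj w + cnj (z * cnj w)) - k * (z * w + cnj (z * w))"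
      by (simp only: complex_add_cnj)
    finally have "2 * K * (z * w) =
        ((z * cnj w + cnj (z * cnj w)) - k * (z * w + cnj (z * w))) * (z * w)"
      by (simp only: of_real_mult of_real_numeral)
    also have "\<dots> = z\<^sup>2 * (w * cnj w) + w\<^sup>2 * (z * cnj z) - k * (z\<^sup>2 * w\<^sup>2 + (z * cnj z) * (w * cnj w))"
      by (simp add: algebra_simps power2_eq_square)
    finally show ?thesis unfolding zw by simp
  qed
  note p12 = pair[OF unit(1,2) conj(1)] and p23 = pair[OF unit(2,3) conj(2)]
    and p31 = pair[OF unit(3,1) conj(3)]
  let ?e2 = "z1 * z2 + z2 * z3 + z3 * z1"
  \<comment> \<open>Two relations sharing \<open>z1\<close> differ by a multiple of
    \<open>z2 - z3\<close>, which can be cancelled. The same elimination is repeated with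
    \<open>z2\<close>, and then once more between the two results.\<close>
  have "(z2 - z3) * ((z2 + z3) - k * z1\<^sup>2 * (z2 + z3) - 2 * K * z1)
      = (z1\<^sup>2 + z2\<^sup>2 - k * (z1\<^sup>2 * z2\<^sup>2 + 1) - 2 * K * (z1 * z2))
      - (z3\<^sup>2 + z1\<^sup>2 - k * (z3\<^sup>2 * z1\<^sup>2 + 1) - 2 * K * (z3 * z1))"
    by (simp add: algebra_simps power2_eq_square)
  then have s1: "(z2 + z3) - k * z1\<^sup>2 * (z2 + z3) - 2 * K * z1 = 0"
    using ne unfolding p12 p31 by simp
  have "(z1 - z3) * ((z1 + z3) - k * z2\<^sup>2 * (z1 + z3) - 2 * K * z2)
      = (z1\<^sup>2 + z2\<^sup>2 - k * (z1\<^sup>2 * z2\<^sup>2 + 1) - 2 * K * (z1 * z2))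
      - (z2\<^sup>2 + z3\<^sup>2 - k * (z2\<^sup>2 * z3\<^sup>2 + 1) - 2 * K * (z2 * z3))"
    by (simp add: algebra_simps power2_eq_square)
  then have s2: "(z1 + z3) - k * z2\<^sup>2 * (z1 + z3) - 2 * K * z2 = 0"
    using ne unfolding p12 p23 by simp
  have "(z2 - z1) * (1 + 2 * K + k * ?e2)
      = ((z2 + z3) - k * z1\<^sup>2 * (z2 + z3) - 2 * K * z1)
        - ((z1 + z3) - k * z2\<^sup>2 * (z1 + z3) - 2 * K * z2)"
    by (simp add: algebra_simps power2_eq_square)
  then have e2: "1 + 2 * K + k * ?e2 = 0" using ne unfolding s1 s2 by simp
  have "z1 + z2 + z3 + k * (z1 * z2 * z3)
      = ((z2 + z3) - k * z1\<^sup>2 * (z2 + z3) - 2 * K * z1) + z1 * (1 + 2 * K + k * ?e2)"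
    by (simp add: algebra_simps power2_eq_square)
  also have "\<dots> = 0" unfolding s1 e2 by simp
  finally have e1: "z1 + z2 + z3 = - (k * (z1 * z2 * z3))"
    by (simp only: eq_neg_iff_add_eq_0)
  then show "cmod (z1 + z2 + z3) = k" using unit k by (simp add: norm_mult)
  \<comment> \<open>On the unit circle \<open>?e2\<close> is the product of the points times the
    conjugate of their sum. The formula for the sum then gives \<open>?e2 = - k\<close>, and the
    relation \<open>e2\<close> becomes the claim.\<close>
  have "?e2 = (z3 * cnj z3) * (z1 * z2) + (z1 * cnj z1) * (z2 * z3) + (z2 * cnj z2) * (z3 * z1)"
    using unit by (simp only: unit_cnj) simp
  also have "\<dots> = z1 * z2 * z3 * cnj (z1 + z2 + z3)" by (simp add: algebra_simps)
  also have "\<dots> = - k * ((z1 * cnj z1) * (z2 * cnj z2) * (z3 * cnj z3))"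
    unfolding e1 by (simp add: mult_ac)
  also have "\<dots> = - k" using unit by (simp only: unit_cnj) simp
  finally have "complex_of_real (1 + 2 * K - k\<^sup>2) = 0"
    using e2 by (simp add: power2_eq_square)
  then show "1 + 2 * K = k\<^sup>2" by (simp only: of_real_eq_0_iff)
qed

section \<open>From the reflection law to the invariant\<close>

text \<open>The normal is a multiple t of the sum of the two unit side directions, hence makes equal
  angles with them. The normalization \<open>gradient a b A \<bullet> A = 1\<close> determines t and
  yields the second equation, which feeds the perimeter formula.\<close>

lemma bisector_gradient:
  assumes "A \<in> elliptic_billiard a b" "billiard_normal a b A = internal_bisector A B C"
    "B \<noteq> A" "C \<noteq> A"
  shows "gradient a b A \<bullet> sgn (B - A) = gradient a b A \<bullet> sgn (C - A)"
    and "(gradient a b A \<bullet> sgn (B - A)) * (A \<bullet> (sgn (B - A) + sgn (C - A))) = 1 + sgn (B - A) \<bullet> sgn (C - A)"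
proof -
  let ?e = "sgn (B - A)" and ?f = "sgn (C - A)"
  have "A + 1 *\<^sub>R gradient a b A \<in> billiard_normal a b A" unfolding billiard_normal_eq by blast
  then have "A + gradient a b A \<in> range (\<lambda>t. A + t *\<^sub>R (?e + ?f))"
    unfolding assms(2) internal_bisector_def by simp
  then obtain t where "A + gradient a b A = A + t *\<^sub>R (?e + ?f)" by blast
  then have t: "gradient a b A = t *\<^sub>R (?e + ?f)" by simp
  have unit: "?e \<bullet> ?e = 1" "?f \<bullet> ?f = 1"
    using assms(3,4) by (simp_all add: norm_eq_1[symmetric] norm_sgn)
  show "gradient a b A \<bullet> ?e = gradient a b A \<bullet> ?f"
    unfolding t by (simp add: inner_simps unit inner_commute)
  have "t * (A \<bullet> (?e + ?f)) = 1"
    using gradient_inner_self[OF assms(1)] unfolding t by (simp add: inner_commute)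
  moreover have "gradient a b A \<bullet> ?e = t * (1 + ?e \<bullet> ?f)"
    unfolding t by (simp add: inner_simps unit inner_commute)
  then have "(gradient a b A \<bullet> ?e) * (A \<bullet> (?e + ?f)) = (1 + ?e \<bullet> ?f) * (t * (A \<bullet> (?e + ?f)))"
    by (simp only: mult_ac)
  ultimately show "(gradient a b A \<bullet> ?e) * (A \<bullet> (?e + ?f)) = 1 + ?e \<bullet> ?f"
    by (simp only: mult_1_right)
qed

text \<open>J is Joachimsthal's constant, conserved along a billiard trajectory. The quotient
  \<open>j\<close> belongs to a side independently of its orientation, and reflection equates it for
  the two sides at each vertex.\<close>

lemma three_periodic_chords:
  assumes "three_periodic a b A B C" "a \<noteq> 0" "b \<noteq> 0"
  obtains J where "0 < J"
    "1 - Re (to_circle a b A * cnj (to_circle a b B)) = J * dist A B"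
    "1 - Re (to_circle a b B * cnj (to_circle a b C)) = J * dist B C"
    "1 - Re (to_circle a b C * cnj (to_circle a b A)) = J * dist C A"
    "J * (dist A B + dist B C + dist C A) = 3 + (sgn (B - A) \<bullet> sgn (C - A)
      + sgn (C - B) \<bullet> sgn (A - B) + sgn (A - C) \<bullet> sgn (B - C))"
proof -
  have nc: "\<not> collinear {A, B, C}"
    and on: "A \<in> elliptic_billiard a b" "B \<in> elliptic_billiard a b" "C \<in> elliptic_billiard a b"
    and bis: "billiard_normal a b A = internal_bisector A B C"
      "billiard_normal a b B = internal_bisector B C A"
      "billiard_normal a b C = internal_bisector C A B"
    using assms(1) unfolding three_periodic_def by auto
  have ne: "A \<noteq> B" "B \<noteq> C" "C \<noteq> A" using nc by (auto simp: insert_commute)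
  define j where "j P Q = (1 - Re (to_circle a b P * cnj (to_circle a b Q))) / dist P Q" for P Q
  have j_commute: "j P Q = j Q P" for P Q
    unfolding j_def by (simp add: dist_commute algebra_simps)
  have j_grad: "gradient a b P \<bullet> sgn (Q - P) = - j P Q" if "P \<in> elliptic_billiard a b" for P Q
  proof -
    have "gradient a b P \<bullet> (Q - P) = Re (to_circle a b P * cnj (to_circle a b Q)) - 1"
      using gradient_inner_self[OF that] by (simp only: inner_diff_right gradient_inner)
    moreover have "gradient a b P \<bullet> sgn (Q - P) = gradient a b P \<bullet> (Q - P) / norm (Q - P)"
      by (simp add: sgn_div_norm divide_inverse_commute)
    ultimately show ?thesis unfolding j_def dist_norm norm_minus_commute[of P Q] minus_divide_left by simp
  qed
  have j: "1 - Re (to_circle a b P * cnj (to_circle a b Q)) = j P Q * dist P Q" if "P \<noteq> Q" for P Q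
    unfolding j_def using that by simp
  note gA = bisector_gradient[OF on(1) bis(1)] and gB = bisector_gradient[OF on(2) bis(2)]
    and gC = bisector_gradient[OF on(3) bis(3)]
  have eq: "j A B = j A C" "j B C = j B A" "j C A = j C B"
    using gA(1) gB(1) gC(1) ne on by (simp_all add: j_grad)
  define J where "J = j A B"
  have J: "j A B = J" "j B C = J" "j C A = J" using eq j_commute unfolding J_def by metis+
  have pos: "0 < J"
    using inner_unit_less_1[of "to_circle a b A" "to_circle a b B"] on ne to_circle_inj[OF assms(2,3)]
    unfolding J_def j_def norm_to_circle by simp
  have "- J * (A \<bullet> (sgn (B - A) + sgn (C - A))) = 1 + sgn (B - A) \<bullet> sgn (C - A)"
    "- J * (B \<bullet> (sgn (C - B) + sgn (A - B))) = 1 + sgn (C - B) \<bullet> sgn (A - B)"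
    "- J * (C \<bullet> (sgn (A - C) + sgn (B - C))) = 1 + sgn (A - C) \<bullet> sgn (B - C)"
    using gA(2) gB(2) gC(2) ne on J by (simp_all add: j_grad)
  then have "3 + (sgn (B - A) \<bullet> sgn (C - A) + sgn (C - B) \<bullet> sgn (A - B) + sgn (A - C) \<bullet> sgn (B - C))
      = - J * (A \<bullet> (sgn (B - A) + sgn (C - A)) + B \<bullet> (sgn (C - B) + sgn (A - B)) + C \<bullet> (sgn (A - C) + sgn (B - C)))"
    unfolding distrib_left[of "- J"] by linarith
  \<comment> \<open>Regrouping by sides instead of vertices: the two end points of a side contribute
    minus its length.\<close>
  also have "A \<bullet> (sgn (B - A) + sgn (C - A)) + B \<bullet> (sgn (C - B) + sgn (A - B)) + C \<bullet> (sgn (A - C) + sgn (B - C))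
      = - (sgn (B - A) \<bullet> (B - A) + sgn (C - B) \<bullet> (C - B) + sgn (A - C) \<bullet> (A - C))"
  proof -
    have "sgn (A - B) = - sgn (B - A)" "sgn (B - C) = - sgn (C - B)" "sgn (C - A) = - sgn (A - C)"
      by (simp_all flip: sgn_minus)
    then show ?thesis by (simp add: inner_simps inner_commute)
  qed
  also have "\<dots> = - (dist A B + dist B C + dist C A)"
    unfolding sgn_inner_self dist_norm by (simp add: norm_minus_commute)
  finally have "J * (dist A B + dist B C + dist C A) = 3 + (sgn (B - A) \<bullet> sgn (C - A)
      + sgn (C - B) \<bullet> sgn (A - B) + sgn (A - C) \<bullet> sgn (B - C))"
    unfolding minus_mult_minus by (rule sym)
  then show thesis using that[OF pos] j ne J by metis
qed

text \<open>The quadratic equation mentions only \<open>a\<close>, \<open>b\<close> and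
  \<open>k\<close>. Since \<open>k\<close> is positive, it is therefore the same for every
  3-periodic of the billiard.\<close>

lemma three_periodic_semiaxes:
  assumes T: "three_periodic a b A B C" and ab: "0 < b" "b < a"
  obtains k R where "0 < k" "k < 1" "(a\<^sup>2 - b\<^sup>2) * k\<^sup>2 + 2 * (a\<^sup>2 + b\<^sup>2) * k = 3 * (a\<^sup>2 - b\<^sup>2)"
    "0 < R" "circumradius A B C = R" "inradius A B C = R * (1 - k\<^sup>2) / 2"
    "dist (incenter A B C) (circumcenter A B C) = R * k"
    "major_semiaxis (incenter_circumellipse A B C) = R * (1 + k)"
    "minor_semiaxis (incenter_circumellipse A B C) = R * (1 - k)"
proof -
  have nc: "\<not> collinear {A, B, C}"
    and on: "A \<in> elliptic_billiard a b" "B \<in> elliptic_billiard a b" "C \<in> elliptic_billiard a b"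
    using T unfolding three_periodic_def by auto
  have ne: "A \<noteq> B" "B \<noteq> C" "C \<noteq> A" using nc by (auto simp: insert_commute)
  have nz: "a \<noteq> 0" "b \<noteq> 0" using ab by auto
  obtain J where J: "0 < J"
    and ch: "1 - Re (to_circle a b A * cnj (to_circle a b B)) = J * dist A B"
      "1 - Re (to_circle a b B * cnj (to_circle a b C)) = J * dist B C"
      "1 - Re (to_circle a b C * cnj (to_circle a b A)) = J * dist C A"
    and per: "J * (dist A B + dist B C + dist C A) = 3 + (sgn (B - A) \<bullet> sgn (C - A)
      + sgn (C - B) \<bullet> sgn (A - B) + sgn (A - C) \<bullet> sgn (B - C))"
    by (rule three_periodic_chords[OF T nz])
  obtain R s where R: "0 < R" and s: "0 \<le> s" "s < 1" and val:
    "circumradius A B C = R" "inradius A B C = R * (1 - s\<^sup>2) / 2"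
    "dist (incenter A B C) (circumcenter A B C) = R * s"
    "major_semiaxis (incenter_circumellipse A B C) = R * (1 + s)"
    "minor_semiaxis (incenter_circumellipse A B C) = R * (1 - s)"
    and cos: "sgn (B - A) \<bullet> sgn (C - A) + sgn (C - B) \<bullet> sgn (A - B) + sgn (A - C) \<bullet> sgn (B - C) = (3 - s\<^sup>2) / 2"
    by (rule triangle_incenter_circumellipse[OF nc])
  define k where "k = J\<^sup>2 * (a\<^sup>2 - b\<^sup>2)"
  have c: "0 < a\<^sup>2 - b\<^sup>2" using ab by (simp add: power2_strict_mono)
  have k: "0 < k" unfolding k_def using J c by simp
  let ?z = "to_circle a b"
  have unit: "cmod (?z A) = 1" "cmod (?z B) = 1" "cmod (?z C) = 1" using on by (simp_all add: norm_to_circle)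
  have zne: "?z A \<noteq> ?z B" "?z B \<noteq> ?z C" "?z C \<noteq> ?z A" using ne by (simp_all add: to_circle_inj[OF nz])
  note conj = chord_iff[OF nz J on(1,2) ne(1), THEN iffD1, OF ch(1), folded k_def]
    chord_iff[OF nz J on(2,3) ne(2), THEN iffD1, OF ch(2), folded k_def]
    chord_iff[OF nz J on(3,1) ne(3), THEN iffD1, OF ch(3), folded k_def]
  have sum: "cmod (?z A + ?z B + ?z C) = k" and K: "1 + 2 * (1 - J\<^sup>2 * (a\<^sup>2 + b\<^sup>2)) = k\<^sup>2"
    using conjugate_triple_on_circle[OF unit zne conj k] by blast+
  \<comment> \<open>The sum of the three inner products on the circle is computed from the chords,
    hence from J times the perimeter, hence from the cosines of the angles. This identifies
    \<open>k\<close> with the ratio \<open>s\<close> of the triangle.\<close>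
  have "k\<^sup>2 = 3 + 2 * (Re (?z A * cnj (?z B)) + Re (?z B * cnj (?z C)) + Re (?z C * cnj (?z A)))"
    unfolding sum[symmetric] by (rule cmod_unit_sum_3[OF unit])
  also have "\<dots> = 3 + 2 * (3 - J * (dist A B + dist B C + dist C A))"
    unfolding distrib_left ch[symmetric] by simp
  also have "\<dots> = s\<^sup>2" unfolding per cos by (simp add: field_simps)
  finally have sk: "s = k" using s k by simp
  have "(a\<^sup>2 - b\<^sup>2) * k\<^sup>2 + 2 * (a\<^sup>2 + b\<^sup>2) * k = 3 * (a\<^sup>2 - b\<^sup>2)"
    unfolding K[symmetric] unfolding k_def by (simp add: algebra_simps)
  then show thesis using that[of k R] k s R val unfolding sk by blast
qed

section \<open>Converse: billiard triangles from the conjugacy relation\<close>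

text \<open>The chord equations give the normal the same inner product \<open>- J\<close> with both
  unit side directions, so it is orthogonal to their difference, as is their sum. In the plane the
  two are parallel, and both are nonzero because \<open>J\<close> is.\<close>

lemma bisector_if_chords:
  assumes on: "A \<in> elliptic_billiard a b" and nc: "\<not> collinear {A, B, C}" and J: "0 < J"
    and ch: "1 - Re (to_circle a b A * cnj (to_circle a b B)) = J * dist A B"
      "1 - Re (to_circle a b A * cnj (to_circle a b C)) = J * dist A C"
  shows "billiard_normal a b A = internal_bisector A B C"
proof -
  have ne: "A \<noteq> B" "A \<noteq> C" using nc by (auto simp: insert_commute)
  let ?e = "sgn (B - A)" and ?f = "sgn (C - A)" and ?g = "gradient a b A"
  have grad: "?g \<bullet> sgn (P - A) = - J"
    if "1 - Re (to_circle a b A * cnj (to_circle a b P)) = J * dist A P" "A \<noteq> P" for P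
  proof -
    have "?g \<bullet> (P - A) = - J * dist A P"
      using gradient_inner_self[OF on] that(1) by (simp only: inner_diff_right gradient_inner)
    moreover have "?g \<bullet> sgn (P - A) = ?g \<bullet> (P - A) / dist A P"
      by (simp add: sgn_div_norm divide_inverse_commute dist_norm norm_minus_commute)
    ultimately show ?thesis using that(2) by simp
  qed
  note grads = grad[OF ch(1) ne(1)] grad[OF ch(2) ne(2)]
  have unit: "?e \<bullet> ?e = 1" "?f \<bullet> ?f = 1"
    using ne by (simp_all add: norm_eq_1[symmetric] norm_sgn)
  have "?e \<noteq> ?f"
  proof
    assume "?e = ?f"
    moreover have "B - A = norm (B - A) *\<^sub>R ?e" "C - A = norm (C - A) *\<^sub>R ?f"
      using ne by (simp_all add: sgn_div_norm)
    ultimately obtain s t e where st: "B - A = s *\<^sub>R e" "C - A = t *\<^sub>R e" by metis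
    have "(B - A)$1 * (C - A)$2 = (B - A)$2 * (C - A)$1" unfolding st by simp
    then show False using collinear_if_cross_eq_0 nc by simp
  qed
  moreover have sum: "?g \<bullet> (?e + ?f) = - 2 * J" by (simp add: inner_add_right grads)
  then have "?e + ?f \<noteq> 0" using J by auto
  moreover have "?g \<bullet> (?e - ?f) = 0" by (simp add: inner_diff_right grads)
  moreover have "(?e + ?f) \<bullet> (?e - ?f) = 0" by (simp add: inner_simps unit inner_commute)
  ultimately obtain t where t: "?g = t *\<^sub>R (?e + ?f)"
    using parallel_if_orthogonal_2[of "?e - ?f" "?e + ?f" ?g] by auto
  have tnz: "t \<noteq> 0" using sum J unfolding t by auto
  have 1: "A + r *\<^sub>R ?g = A + (r * t) *\<^sub>R (?e + ?f)"
    and 2: "A + r *\<^sub>R (?e + ?f) = A + (r / t) *\<^sub>R ?g" for r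
    unfolding t using tnz by simp_all
  show ?thesis
    unfolding billiard_normal_eq internal_bisector_def
  proof (rule subset_antisym; rule image_subsetI)
    fix r
    show "A + r *\<^sub>R ?g \<in> range (\<lambda>r. A + r *\<^sub>R (?e + ?f))" unfolding 1 by (rule rangeI)
    show "A + r *\<^sub>R (?e + ?f) \<in> range (\<lambda>r. A + r *\<^sub>R ?g)" unfolding 2 by (rule rangeI)
  qed
qed

lemma three_periodic_if_chords:
  assumes "A \<in> elliptic_billiard a b" "B \<in> elliptic_billiard a b" "C \<in> elliptic_billiard a b"
    and nc: "\<not> collinear {A, B, C}" and J: "0 < J"
    and ch: "1 - Re (to_circle a b A * cnj (to_circle a b B)) = J * dist A B"
      "1 - Re (to_circle a b B * cnj (to_circle a b C)) = J * dist B C"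
      "1 - Re (to_circle a b C * cnj (to_circle a b A)) = J * dist C A"
  shows "three_periodic a b A B C"
proof -
  have sym: "1 - Re (to_circle a b Q * cnj (to_circle a b P)) = J * dist Q P"
    if "1 - Re (to_circle a b P * cnj (to_circle a b Q)) = J * dist P Q" for P Q
    using that by (simp add: dist_commute mult.commute)
  show ?thesis
    unfolding three_periodic_def
    using assms sym bisector_if_chords[OF assms(1) _ J] bisector_if_chords[OF assms(2) _ J]
      bisector_if_chords[OF assms(3) _ J] by (simp add: insert_commute)
qed

lemma three_periodic_if_conjugate:
  assumes ab: "0 < b" "b < a" and k: "0 < k"
    and quad: "(a\<^sup>2 - b\<^sup>2) * k\<^sup>2 + 2 * (a\<^sup>2 + b\<^sup>2) * k = 3 * (a\<^sup>2 - b\<^sup>2)"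
    and on: "A \<in> elliptic_billiard a b" "B \<in> elliptic_billiard a b" "C \<in> elliptic_billiard a b"
    and nc: "\<not> collinear {A, B, C}"
    and conj: "Re (to_circle a b A * cnj (to_circle a b B)) - k * Re (to_circle a b A * to_circle a b B) = (k\<^sup>2 - 1) / 2"
      "Re (to_circle a b B * cnj (to_circle a b C)) - k * Re (to_circle a b B * to_circle a b C) = (k\<^sup>2 - 1) / 2"
      "Re (to_circle a b C * cnj (to_circle a b A)) - k * Re (to_circle a b C * to_circle a b A) = (k\<^sup>2 - 1) / 2"
  shows "three_periodic a b A B C"
proof -
  have ne: "A \<noteq> B" "B \<noteq> C" "C \<noteq> A" using nc by (auto simp: insert_commute)
  have nz: "a \<noteq> 0" "b \<noteq> 0" using ab by auto
  have c: "0 < a\<^sup>2 - b\<^sup>2" using ab by (simp add: power2_strict_mono)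
  \<comment> \<open>Inverts \<open>k = J\<^sup>2 * (a\<^sup>2 - b\<^sup>2)\<close>. The quadratic
    equation for \<open>k\<close> then makes the constant of \<open>chord_iff\<close> equal to
    \<open>(k\<^sup>2 - 1) / 2\<close>.\<close>
  define J where "J = sqrt (k / (a\<^sup>2 - b\<^sup>2))"
  have J: "0 < J" unfolding J_def using k c by simp
  have J2: "J\<^sup>2 = k / (a\<^sup>2 - b\<^sup>2)" unfolding J_def using k c by simp
  have Jk: "J\<^sup>2 * (a\<^sup>2 - b\<^sup>2) = k" unfolding J2 using c by simp
  have "(a\<^sup>2 - b\<^sup>2) * (k\<^sup>2 + 2 * (J\<^sup>2 * (a\<^sup>2 + b\<^sup>2)) - 3)
      = (a\<^sup>2 - b\<^sup>2) * k\<^sup>2 + 2 * (a\<^sup>2 + b\<^sup>2) * (J\<^sup>2 * (a\<^sup>2 - b\<^sup>2)) - 3 * (a\<^sup>2 - b\<^sup>2)"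
    by (simp add: algebra_simps)
  also have "\<dots> = 0" unfolding Jk using quad by simp
  finally have K: "1 - J\<^sup>2 * (a\<^sup>2 + b\<^sup>2) = (k\<^sup>2 - 1) / 2" using c by simp
  show ?thesis
    using three_periodic_if_chords[OF on nc J] chord_iff[OF nz J on(1,2) ne(1)]
      chord_iff[OF nz J on(2,3) ne(2)] chord_iff[OF nz J on(3,1) ne(3)] conj
    unfolding Jk K by blast
qed

section \<open>Two isosceles billiard triangles\<close>

context
  fixes a b k :: real
  assumes ab: "0 < b" "b < a" and k: "0 < k" "k < 1"
    and quad: "(a\<^sup>2 - b\<^sup>2) * k\<^sup>2 + 2 * (a\<^sup>2 + b\<^sup>2) * k = 3 * (a\<^sup>2 - b\<^sup>2)"
begin

lemma isosceles_minor_apex: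
  "\<exists>A B C. three_periodic a b A B C \<and>
     circumradius A B C = (a\<^sup>2 * (1 + k) + b\<^sup>2 * (3 - k)) / (4 * b)"
proof -
  \<comment> \<open>The apex is sent to the point i of the circle. Its conjugacy with a base vertex
    reads \<open>y * (1 + k) = (k\<^sup>2 - 1) / 2\<close>; this value of \<open>y\<close> also
    satisfies the relation between the base vertices.\<close>
  define y where "y = (k - 1) / 2"
  define x where "x = sqrt (1 - y\<^sup>2)"
  have y: "-1 < y" "y < 1" unfolding y_def using k by auto
  then have "y\<^sup>2 < 1" by (simp add: abs_square_less_1)
  then have x: "0 < x" "x\<^sup>2 = 1 - y\<^sup>2" unfolding x_def by auto
  define A B C :: "real^2" where "A = vector [0, b]" and "B = vector [a * x, b * y]"
    and "C = vector [- (a * x), b * y]"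
  define r where "r = (a\<^sup>2 * (1 + k) + b\<^sup>2 * (3 - k)) / (4 * b)"
  have nc: "\<not> collinear {A, B, C}"
  proof
    assume "collinear {A, B, C}"
    from cross_eq_0_if_collinear[OF this] show False
      unfolding A_def B_def C_def using x y ab by (simp add: algebra_simps)
  qed
  have circ: "to_circle a b A = Complex 0 1" "to_circle a b B = Complex x y" "to_circle a b C = Complex (-x) y"
    unfolding to_circle_def A_def B_def C_def using ab by simp_all
  have on: "A \<in> elliptic_billiard a b" "B \<in> elliptic_billiard a b" "C \<in> elliptic_billiard a b"
    unfolding norm_to_circle circ using x(2) by (simp_all add: cmod_def)
  have Re_eq: "Re (to_circle a b A * cnj (to_circle a b B)) = y" "Re (to_circle a b A * to_circle a b B) = - y"
    "Re (to_circle a b B * cnj (to_circle a b C)) = 2 * y\<^sup>2 - 1" "Re (to_circle a b B * to_circle a b C) = - 1"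
    "Re (to_circle a b C * cnj (to_circle a b A)) = y" "Re (to_circle a b C * to_circle a b A) = - y"
    using x(2) by (simp_all add: circ power2_eq_square)
  have "y * (1 + k) = (k\<^sup>2 - 1) / 2" "2 * y\<^sup>2 - 1 + k = (k\<^sup>2 - 1) / 2"
    unfolding y_def by (simp_all add: power2_eq_square field_simps)
  then have "three_periodic a b A B C"
    by (intro three_periodic_if_conjugate[OF ab k(1) quad on nc]; unfold Re_eq)
      (simp_all add: algebra_simps)
  moreover have "circumradius A B C = r"
  \<comment> \<open>By symmetry the circumcenter lies on the vertical axis, at distance
    \<open>r\<close> below the apex; equating distances to apex and base determines
    \<open>r\<close>.\<close>
  proof (rule circumradius_eq[OF nc, where P = "vector [0, b - r]"])
    have r: "0 < r" unfolding r_def using ab k by (intro divide_pos_pos add_pos_pos mult_pos_pos) auto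
    have "2 * (b * (1 - y)) * r = (1 - y) * (a\<^sup>2 * (1 + y) + b\<^sup>2 * (1 - y))"
      unfolding r_def y_def using ab by (simp add: field_simps)
    then have eq: "(a * x)\<^sup>2 + (b - r - b * y)\<^sup>2 = r\<^sup>2"
      unfolding power_mult_distrib x(2) by (simp add: power2_eq_square algebra_simps)
    show "dist (vector [0, b - r]) A = r" "dist (vector [0, b - r]) B = r" "dist (vector [0, b - r]) C = r"
      unfolding dist_norm norm_2 A_def B_def C_def using r eq by simp_all
  qed
  ultimately show ?thesis unfolding r_def by blast
qed

lemma isosceles_major_apex:
  "\<exists>A B C. three_periodic a b A B C \<and>
     circumradius A B C = (a\<^sup>2 * (3 + k) + b\<^sup>2 * (1 - k)) / (4 * a)"
proof -
  \<comment> \<open>The apex is sent to 1, and conjugacy with a base vertex reads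
    \<open>x * (1 - k) = (k\<^sup>2 - 1) / 2\<close>.\<close>
  define x where "x = - (1 + k) / 2"
  define y where "y = sqrt (1 - x\<^sup>2)"
  have x: "-1 < x" "x < 1" unfolding x_def using k by auto
  then have "x\<^sup>2 < 1" by (simp add: abs_square_less_1)
  then have y: "0 < y" "y\<^sup>2 = 1 - x\<^sup>2" unfolding y_def by auto
  define A B C :: "real^2" where "A = vector [a, 0]" and "B = vector [a * x, b * y]"
    and "C = vector [a * x, - (b * y)]"
  define r where "r = (a\<^sup>2 * (3 + k) + b\<^sup>2 * (1 - k)) / (4 * a)"
  have nc: "\<not> collinear {A, B, C}"
  proof
    assume "collinear {A, B, C}"
    from cross_eq_0_if_collinear[OF this] show False
      unfolding A_def B_def C_def using x y ab by (simp add: algebra_simps)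
  qed
  have circ: "to_circle a b A = 1" "to_circle a b B = Complex x y" "to_circle a b C = Complex x (-y)"
    unfolding to_circle_def A_def B_def C_def using ab by (simp_all add: complex_eq_iff)
  have on: "A \<in> elliptic_billiard a b" "B \<in> elliptic_billiard a b" "C \<in> elliptic_billiard a b"
    unfolding norm_to_circle circ using y(2) by (simp_all add: cmod_def)
  have Re_eq: "Re (to_circle a b A * cnj (to_circle a b B)) = x" "Re (to_circle a b A * to_circle a b B) = x"
    "Re (to_circle a b B * cnj (to_circle a b C)) = 2 * x\<^sup>2 - 1" "Re (to_circle a b B * to_circle a b C) = 1"
    "Re (to_circle a b C * cnj (to_circle a b A)) = x" "Re (to_circle a b C * to_circle a b A) = x"
    using y(2) by (simp_all add: circ power2_eq_square)
  have "x * (1 - k) = (k\<^sup>2 - 1) / 2" "2 * x\<^sup>2 - 1 - k = (k\<^sup>2 - 1) / 2"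
    unfolding x_def by (simp_all add: power2_eq_square field_simps)
  then have "three_periodic a b A B C"
    by (intro three_periodic_if_conjugate[OF ab k(1) quad on nc]; unfold Re_eq)
      (simp_all add: algebra_simps)
  moreover have "circumradius A B C = r"
  proof (rule circumradius_eq[OF nc, where P = "vector [a - r, 0]"])
    have r: "0 < r" unfolding r_def using ab k by (intro divide_pos_pos add_pos_pos mult_pos_pos) auto
    have "2 * (a * (1 - x)) * r = (1 - x) * (a\<^sup>2 * (1 - x) + b\<^sup>2 * (1 + x))"
      unfolding r_def x_def using ab by (simp add: field_simps)
    then have eq: "(a - r - a * x)\<^sup>2 + (b * y)\<^sup>2 = r\<^sup>2"
      unfolding power_mult_distrib y(2) by (simp add: power2_eq_square algebra_simps)
    show "dist (vector [a - r, 0]) A = r" "dist (vector [a - r, 0]) B = r" "dist (vector [a - r, 0]) C = r"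
      unfolding dist_norm norm_2 A_def B_def C_def using r eq by simp_all
  qed
  ultimately show ?thesis unfolding r_def by blast
qed

text \<open>After cross-multiplication the difference factors as
  \<open>(a - b)\<^sup>2 * (a * (1 + k) - b * (1 - k))\<close>, and both factors are
  positive.\<close>

lemma isosceles_circumradii_differ:
  "(a\<^sup>2 * (1 + k) + b\<^sup>2 * (3 - k)) / (4 * b) \<noteq> (a\<^sup>2 * (3 + k) + b\<^sup>2 * (1 - k)) / (4 * a)"
proof -
  have "b * (1 - k) < a * (1 + k)" using ab k by (intro mult_strict_mono) auto
  then have "(a - b)\<^sup>2 * (a * (1 + k) - b * (1 - k)) \<noteq> 0" using ab by simp
  moreover have "(a - b)\<^sup>2 * (a * (1 + k) - b * (1 - k))
      = a * (a\<^sup>2 * (1 + k) + b\<^sup>2 * (3 - k)) - b * (a\<^sup>2 * (3 + k) + b\<^sup>2 * (1 - k))"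
    by (simp add: power2_eq_square algebra_simps)
  moreover have "X / (4 * b) \<noteq> Y / (4 * a)" if "a * X - b * Y \<noteq> 0" for X Y
    using that ab by (auto simp: field_simps)
  ultimately show ?thesis by simp
qed

end

section \<open>The quadratic equation that determines k\<close>

lemma invariant_quadratic_root_unique:
  fixes p q r k k' :: real
  assumes "0 < p" "0 < q" "0 < k" "0 < k'" "p * k\<^sup>2 + q * k = r" "p * k'\<^sup>2 + q * k' = r"
  shows "k = k'"
proof -
  have "(k - k') * (p * (k + k') + q) = 0"
    using assms(5,6) by (simp add: algebra_simps power2_eq_square)
  moreover have "0 < p * (k + k') + q" using assms by (simp add: add_pos_pos)
  ultimately show ?thesis by simp
qed

lemma invariant_quadratic_root_exists:
  fixes p q :: real
  assumes "0 < p" "p < q"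
  shows "\<exists>k. 0 < k \<and> k < 1 \<and> p * k\<^sup>2 + 2 * q * k = 3 * p"
proof -
  \<comment> \<open>The larger root from the quadratic formula. It is positive since the square root
    exceeds \<open>q\<close>, and below 1 because \<open>p < q\<close>.\<close>
  let ?k = "(sqrt (q\<^sup>2 + 3 * p\<^sup>2) - q) / p"
  have s: "(sqrt (q\<^sup>2 + 3 * p\<^sup>2))\<^sup>2 = q\<^sup>2 + 3 * p\<^sup>2" by simp
  have "q < sqrt (q\<^sup>2 + 3 * p\<^sup>2)" using assms by (intro real_less_rsqrt) simp
  then have "0 < ?k" using assms by simp
  moreover have "p * p < q * p" using assms by simp
  then have "sqrt (q\<^sup>2 + 3 * p\<^sup>2) < p + q"
    using assms by (intro real_less_lsqrt) (simp_all add: power2_eq_square algebra_simps)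
  then have "?k < 1" using assms by simp
  moreover have "p * ?k\<^sup>2 + 2 * q * ?k = ((sqrt (q\<^sup>2 + 3 * p\<^sup>2))\<^sup>2 - q\<^sup>2) / p"
    using assms by (simp add: power2_eq_square field_simps)
  then have "p * ?k\<^sup>2 + 2 * q * ?k = 3 * p"
    unfolding s using assms by (simp add: power2_eq_square)
  ultimately show ?thesis by blast
qed

theorem theorem1:
  fixes a b :: real
  assumes "0 < b" and "b < a"
  shows
    "(\<nexists>k. \<forall>A B C. three_periodic a b A B C \<longrightarrow>
         major_semiaxis (incenter_circumellipse A B C) = k) \<and>
     (\<nexists>k. \<forall>A B C. three_periodic a b A B C \<longrightarrow>
         minor_semiaxis (incenter_circumellipse A B C) = k) \<and>
     (\<exists>k. \<forall>A B C. three_periodic a b A B C \<longrightarrow>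
         major_semiaxis (incenter_circumellipse A B C) /
         minor_semiaxis (incenter_circumellipse A B C) = k) \<and>
     (\<forall>A B C. three_periodic a b A B C \<longrightarrow>
        (let r = inradius A B C;
             R = circumradius A B C;
             \<rho> = r / R;
             d = dist (incenter A B C) (circumcenter A B C);
             \<eta>' = major_semiaxis (incenter_circumellipse A B C);
             \<eta> = minor_semiaxis (incenter_circumellipse A B C)
         in d = sqrt (R * (R - 2 * r)) \<and>
            \<eta>' = R + d \<and>
            \<eta> = R - d \<and>
            \<eta>' / \<eta> = (R + d) / (R - d) \<and>
            (R + d) / (R - d) = (1 + sqrt (1 - 2 * \<rho>)) / \<rho> - 1 \<and>
            (1 + sqrt (1 - 2 * \<rho>)) / \<rho> - 1 > 1))"
proof -
  have c: "0 < a\<^sup>2 - b\<^sup>2" using assms by (simp add: power2_strict_mono)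
  have "a\<^sup>2 - b\<^sup>2 < a\<^sup>2 + b\<^sup>2" using assms by simp
  then obtain k where k: "0 < k" "k < 1"
    and quad: "(a\<^sup>2 - b\<^sup>2) * k\<^sup>2 + 2 * (a\<^sup>2 + b\<^sup>2) * k = 3 * (a\<^sup>2 - b\<^sup>2)"
    using invariant_quadratic_root_exists[OF c] by blast
  have val: "0 < circumradius A B C"
    "inradius A B C = circumradius A B C * (1 - k\<^sup>2) / 2"
    "dist (incenter A B C) (circumcenter A B C) = circumradius A B C * k"
    "major_semiaxis (incenter_circumellipse A B C) = circumradius A B C * (1 + k)"
    "minor_semiaxis (incenter_circumellipse A B C) = circumradius A B C * (1 - k)"
    if T: "three_periodic a b A B C" for A B C
  proof -
    obtain k' R where k': "0 < k'" "(a\<^sup>2 - b\<^sup>2) * k'\<^sup>2 + 2 * (a\<^sup>2 + b\<^sup>2) * k' = 3 * (a\<^sup>2 - b\<^sup>2)"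
      and R: "0 < R" "circumradius A B C = R" "inradius A B C = R * (1 - k'\<^sup>2) / 2"
      "dist (incenter A B C) (circumcenter A B C) = R * k'"
      "major_semiaxis (incenter_circumellipse A B C) = R * (1 + k')"
      "minor_semiaxis (incenter_circumellipse A B C) = R * (1 - k')"
      by (rule three_periodic_semiaxes[OF T assms])
    have "0 < 2 * (a\<^sup>2 + b\<^sup>2)" using c assms by (simp add: add_pos_pos)
    then have "k' = k" using invariant_quadratic_root_unique[OF c] k k' quad by blast
    then show "0 < circumradius A B C"
      "inradius A B C = circumradius A B C * (1 - k\<^sup>2) / 2"
      "dist (incenter A B C) (circumcenter A B C) = circumradius A B C * k"
      "major_semiaxis (incenter_circumellipse A B C) = circumradius A B C * (1 + k)"
      "minor_semiaxis (incenter_circumellipse A B C) = circumradius A B C * (1 - k)"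
      using R by simp_all
  qed
  \<comment> \<open>With \<open>k\<close> fixed by the billiard, both semiaxes are fixed positive
    multiples of the circumradius, so two different circumradii make both of them vary.\<close>
  obtain A B C A' B' C' where T: "three_periodic a b A B C" "three_periodic a b A' B' C'"
    and ne: "circumradius A B C \<noteq> circumradius A' B' C'"
    using isosceles_minor_apex[OF assms k quad] isosceles_major_apex[OF assms k quad]
      isosceles_circumradii_differ[OF assms k quad] by metis
  have "circumradius A B C * (1 + k) \<noteq> circumradius A' B' C' * (1 + k)"
    "circumradius A B C * (1 - k) \<noteq> circumradius A' B' C' * (1 - k)"
    using ne k by simp_all
  then have var: "\<nexists>m. \<forall>A B C. three_periodic a b A B C \<longrightarrow>
         major_semiaxis (incenter_circumellipse A B C) = m"
    "\<nexists>m. \<forall>A B C. three_periodic a b A B C \<longrightarrow>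
         minor_semiaxis (incenter_circumellipse A B C) = m"
    using T val by metis+
  have ratio: "\<exists>m. \<forall>A B C. three_periodic a b A B C \<longrightarrow>
         major_semiaxis (incenter_circumellipse A B C) /
         minor_semiaxis (incenter_circumellipse A B C) = m"
  proof (intro exI allI impI)
    fix A B C assume T: "three_periodic a b A B C"
    show "major_semiaxis (incenter_circumellipse A B C) /
        minor_semiaxis (incenter_circumellipse A B C) = (1 + k) / (1 - k)"
      using val[OF T] by simp
  qed
  have k2: "0 < 1 - k\<^sup>2" using k by (simp add: power_less_one_iff abs_square_less_1)
  \<comment> \<open>Here \<rho> is \<open>(1 - k\<^sup>2) / 2\<close>, so the square root is
    \<open>k\<close> and the quotient cancels to \<open>2 / (1 - k)\<close>.\<close>
  have formula: "(1 + sqrt (1 - 2 * ((1 - k\<^sup>2) / 2))) / ((1 - k\<^sup>2) / 2) - 1 = (1 + k) / (1 - k)"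
  proof -
    have "1 - k\<^sup>2 = (1 - k) * (1 + k)" by (simp add: power2_eq_square algebra_simps)
    moreover have "1 - k \<noteq> 0" "1 + k \<noteq> 0" using k by auto
    then have "(1 + k) / ((1 - k) * (1 + k) / 2) = 2 / (1 - k)" by (simp add: frac_eq_eq)
    ultimately have "(1 + k) / ((1 - k\<^sup>2) / 2) = 2 / (1 - k)" by (simp only:)
    moreover have "2 / (1 - k) - 1 = (1 + k) / (1 - k)" using k by (simp add: field_simps)
    moreover have "1 - 2 * ((1 - k\<^sup>2) / 2) = k\<^sup>2" by (simp add: field_simps)
    then have "sqrt (1 - 2 * ((1 - k\<^sup>2) / 2)) = k" using k by simp
    ultimately show ?thesis by simp
  qed
  have gt: "1 < (1 + k) / (1 - k)" using k by simp
  show ?thesis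
  proof (intro conjI var ratio allI impI, unfold Let_def)
    fix A B C assume T: "three_periodic a b A B C"
    define R where "R = circumradius A B C"
    note v = val[OF T, folded R_def]
    have "sqrt (R * (R - 2 * (R * (1 - k\<^sup>2) / 2))) = sqrt ((R * k)\<^sup>2)"
      by (simp add: power2_eq_square field_simps)
    also have "\<dots> = R * k" using v(1) k by simp
    finally have d: "sqrt (R * (R - 2 * (R * (1 - k\<^sup>2) / 2))) = R * k" .
    have \<rho>: "R * (1 - k\<^sup>2) / 2 / R = (1 - k\<^sup>2) / 2" using v(1) by simp
    have e: "R + R * k = R * (1 + k)" "R - R * k = R * (1 - k)" by (simp_all add: algebra_simps)
    show "dist (incenter A B C) (circumcenter A B C) =
          sqrt (circumradius A B C * (circumradius A B C - 2 * inradius A B C)) \<and>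
        major_semiaxis (incenter_circumellipse A B C) =
          circumradius A B C + dist (incenter A B C) (circumcenter A B C) \<and>
        minor_semiaxis (incenter_circumellipse A B C) =
          circumradius A B C - dist (incenter A B C) (circumcenter A B C) \<and>
        major_semiaxis (incenter_circumellipse A B C) / minor_semiaxis (incenter_circumellipse A B C) =
          (circumradius A B C + dist (incenter A B C) (circumcenter A B C)) /
          (circumradius A B C - dist (incenter A B C) (circumcenter A B C)) \<and>
        (circumradius A B C + dist (incenter A B C) (circumcenter A B C)) /
          (circumradius A B C - dist (incenter A B C) (circumcenter A B C)) =
          (1 + sqrt (1 - 2 * (inradius A B C / circumradius A B C))) /
          (inradius A B C / circumradius A B C) - 1 \<and>
        1 < (1 + sqrt (1 - 2 * (inradius A B C / circumradius A B C))) /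
          (inradius A B C / circumradius A B C) - 1"
      unfolding R_def[symmetric] v(2-5) d \<rho> formula e using gt v(1) by simp
  qed
qed

end
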